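(* Let $P$ be an irreducible stochastic matrix on the finite state space $S$, with stationary distribution $\pi$, and let $f:S\to[a,b]$ be a real-valued function, where $a:=\min_{x\in S} f(x)$ and $b:=\max_{x\in S} f(x)$. Put $S_b:=\{x\in S: f(x)=b\}$, and assume that (i) the submatrix of $P$ with rows and columns in $S_b$ is irreducible, and (ii) for every $x\in S\setminus S_b$ there exists $y\in S_b$ such that $P(x,y)>0$. Then $$D(\mu\,\|\,\pi(f))\ge\frac12\,\frac{(\mu-\pi(f))^2}{\sigma_u^2}\ge 2\,\frac{(\mu-\pi(f))^2}{(b-a+2K_uL_u)^2},\quad\text{for any }\mu\ge\pi(f),$$ where $\sigma_u^2=\sigma_u^2(P,f):=\sup_{\theta\ge0}\Lambda''(\theta)\in(0,\infty)$, and $K_u:=\sup_{\theta\ge 0,\;x,y\in S}\frac{v_\theta(x)}{v_\theta(y)}<\infty$ and $L_u:=\sup_{\theta\ge 0,\;x,y\in S}\left|\frac{d}{d\theta}\frac{v_\theta(x)}{v_\theta(y)}\right|<\infty$ are constants depending on $P$ and $f$.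
   Context: A square nonnegative matrix $A$ is irreducible if for all indices $x,y$ there is $n\ge1$ with $A^n(x,y)>0$ (in particular the $1\times1$ zero matrix is not irreducible). $\pi(f):=\sum_x f(x)\pi(x)$. For $\theta\in\mathbb{R}$ let $\tilde P_\theta(x,y):=P(x,y)e^{\theta f(y)}$, which is nonnegative and irreducible; let $\rho(\theta)$ be its spectral radius, and let $u_\theta,v_\theta$ be the unique entrywise positive left and right eigenvectors of $\tilde P_\theta$ for $\rho(\theta)$ with $\sum_x u_\theta(x)=1$ and $\sum_x u_\theta(x)v_\theta(x)=1$. $\Lambda(\theta):=\log\rho(\theta)$. The tilted stochastic matrix is $P_\theta(x,y):=\frac{\tilde P_\theta(x,y)v_\theta(y)}{\rho(\theta)v_\theta(x)}$, with stationary distribution $\pi_\theta(x):=u_\theta(x)v_\theta(x)$; $P_0=P$, $\pi_0=\pi$, and $\Lambda'(\theta)=\pi_\theta(f)$, so $\Lambda'(0)=\pi(f)$. For $\theta_1,\theta_2\in\mathbb{R}$, the relative entropy rate is $D(\theta_1\|\theta_2):=\sum_{x,y}\pi_{\theta_1}(x)P_{\theta_1}(x,y)\log\frac{P_{\theta_1}(x,y)}{P_{\theta_2}(x,y)}$ (with $0\log\frac00=0$), and, with $\mu_i=\Lambda'(\theta_i)$, one also writes $D(\mu_1\|\mu_2):=D(\theta_1\|\theta_2)$. Thus $D(\mu\|\pi(f))=D(\theta\|0)$ when $\mu=\Lambda'(\theta)$; every $\mu\in[\pi(f),b)$ is of this form for some $\theta\ge0$. At the endpoint, $D(b\|\pi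(f)):=\lim_{\theta\to\infty}D(\theta\|0)$.
   Formalization: The formal theorem assumes a < b (f nonconstant), since for constant f one has σ_u² = 0, contradicting σ_u² ∈ (0,∞); and "any μ ≥ π(f)" is read as π(f) ≤ μ ≤ b, the range where D(μ‖π(f)) is defined. *)

theory Defs
  imports "HOL-Analysis.Analysis"
begin

definition stochastic_matrix :: "real^'s^'s \<Rightarrow> bool" where
  "stochastic_matrix P \<longleftrightarrow>
     (\<forall>x y. 0 \<le> P $ x $ y) \<and> (\<forall>x. (\<Sum>y\<in>UNIV. P $ x $ y) = 1)"

definition stationary_distribution :: "real^'s^'s \<Rightarrow> real^'s \<Rightarrow> bool" where
  "stationary_distribution P \<pi> \<longleftrightarrow>
     (\<forall>x. 0 \<le> \<pi> $ x) \<and> (\<Sum>x\<in>UNIV. \<pi> $ x) = 1 \<and> \<pi> v* P = \<pi>"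

(* Powers of the submatrix with rows and columns in T; meaningful for x, y in T.
   The operation (^) on nested vectors is the componentwise power, not the matrix power. *)
primrec submatrix_power :: "'s::finite set \<Rightarrow> real^'s^'s \<Rightarrow> nat \<Rightarrow> 's \<Rightarrow> 's \<Rightarrow> real" where
  "submatrix_power T A 0 x y = (if x = y then 1 else 0)"
| "submatrix_power T A (Suc n) x y = (\<Sum>z\<in>T. A $ x $ z * submatrix_power T A n z y)"

definition irreducible_on :: "'s::finite set \<Rightarrow> real^'s^'s \<Rightarrow> bool" where
  "irreducible_on T A \<longleftrightarrow>
     (\<forall>x\<in>T. \<forall>y\<in>T. 0 \<le> A $ x $ y) \<and>
     (\<forall>x\<in>T. \<forall>y\<in>T. \<exists>n\<ge>1. 0 < submatrix_power T A n x y)"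

definition spectral_radius :: "real^'s^'s \<Rightarrow> real" where
  "spectral_radius A =
     Sup {cmod l | l. \<exists>w. w \<noteq> 0 \<and> map_matrix complex_of_real A *v w = l *s w}"

definition left_perron :: "real^'s^'s \<Rightarrow> real^'s" where
  "left_perron A =
     (THE u. (\<forall>x. 0 < u $ x) \<and> u v* A = spectral_radius A *s u \<and> (\<Sum>x\<in>UNIV. u $ x) = 1)"

definition right_perron :: "real^'s^'s \<Rightarrow> real^'s" where
  "right_perron A =
     (THE v. (\<forall>x. 0 < v $ x) \<and> A *v v = spectral_radius A *s v \<and>
             (\<Sum>x\<in>UNIV. left_perron A $ x * v $ x) = 1)"

definition mean :: "real^'s \<Rightarrow> ('s \<Rightarrow> real) \<Rightarrow> real" where
  "mean \<pi> f = (\<Sum>x\<in>UNIV. f x * \<pi> $ x)"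

definition tilted :: "real^'s^'s \<Rightarrow> ('s \<Rightarrow> real) \<Rightarrow> real \<Rightarrow> real^'s^'s" where
  "tilted P f \<theta> = (\<chi> x y. P $ x $ y * exp (\<theta> * f y))"

definition rho :: "real^'s^'s \<Rightarrow> ('s \<Rightarrow> real) \<Rightarrow> real \<Rightarrow> real" where
  "rho P f \<theta> = spectral_radius (tilted P f \<theta>)"

definition u_vec :: "real^'s^'s \<Rightarrow> ('s \<Rightarrow> real) \<Rightarrow> real \<Rightarrow> real^'s" where
  "u_vec P f \<theta> = left_perron (tilted P f \<theta>)"

definition v_vec :: "real^'s^'s \<Rightarrow> ('s \<Rightarrow> real) \<Rightarrow> real \<Rightarrow> real^'s" where
  "v_vec P f \<theta> = right_perron (tilted P f \<theta>)"

definition Lambda :: "real^'s^'s \<Rightarrow> ('s \<Rightarrow> real) \<Rightarrow> real \<Rightarrow> real" where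
  "Lambda P f \<theta> = ln (rho P f \<theta>)"

definition tilted_chain :: "real^'s^'s \<Rightarrow> ('s \<Rightarrow> real) \<Rightarrow> real \<Rightarrow> real^'s^'s" where
  "tilted_chain P f \<theta> =
     (\<chi> x y. tilted P f \<theta> $ x $ y * v_vec P f \<theta> $ y / (rho P f \<theta> * v_vec P f \<theta> $ x))"

definition tilted_stationary :: "real^'s^'s \<Rightarrow> ('s \<Rightarrow> real) \<Rightarrow> real \<Rightarrow> real^'s" where
  "tilted_stationary P f \<theta> = (\<chi> x. u_vec P f \<theta> $ x * v_vec P f \<theta> $ x)"

(* Tilted chains have the same zero pattern, so a vanishing numerator comes only with a
   vanishing denominator; the leading factor 0 then realises 0 log (0/0) = 0. *)
definition rel_entropy_rate ::
  "real^'s^'s \<Rightarrow> ('s \<Rightarrow> real) \<Rightarrow> real \<Rightarrow> real \<Rightarrow> real" where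
  "rel_entropy_rate P f \<theta>1 \<theta>2 =
     (\<Sum>x\<in>UNIV. \<Sum>y\<in>UNIV. tilted_stationary P f \<theta>1 $ x * tilted_chain P f \<theta>1 $ x $ y *
        ln (tilted_chain P f \<theta>1 $ x $ y / tilted_chain P f \<theta>2 $ x $ y))"

definition param_of_mean :: "real^'s^'s \<Rightarrow> ('s \<Rightarrow> real) \<Rightarrow> real \<Rightarrow> real" where
  "param_of_mean P f \<mu> = (THE \<theta>. deriv (Lambda P f) \<theta> = \<mu>)"

(* Intended for means \<mu>1 in the range of Lambda' or \<mu>1 = max f, the supremum of that range,
   which is not attained for the chains considered here and is reached in the limit. *)
definition rel_entropy_mean ::
  "real^'s^'s \<Rightarrow> ('s::finite \<Rightarrow> real) \<Rightarrow> real \<Rightarrow> real \<Rightarrow> real" where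
  "rel_entropy_mean P f \<mu>1 \<mu>2 =
     (if \<mu>1 = Max (range f)
      then Lim at_top (\<lambda>\<theta>. rel_entropy_rate P f \<theta> (param_of_mean P f \<mu>2))
      else rel_entropy_rate P f (param_of_mean P f \<mu>1) (param_of_mean P f \<mu>2))"

(* The suprema are taken in the extended reals, so that finiteness is a genuine claim. *)

definition sigma_u_sq :: "real^'s^'s \<Rightarrow> ('s \<Rightarrow> real) \<Rightarrow> ereal" where
  "sigma_u_sq P f = (SUP \<theta>\<in>{0..}. ereal (deriv (deriv (Lambda P f)) \<theta>))"

definition K_u :: "real^'s^'s \<Rightarrow> ('s \<Rightarrow> real) \<Rightarrow> ereal" where
  "K_u P f = (SUP \<theta>\<in>{0..}. SUP x. SUP y. ereal (v_vec P f \<theta> $ x / v_vec P f \<theta> $ y))"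

definition L_u :: "real^'s^'s \<Rightarrow> ('s \<Rightarrow> real) \<Rightarrow> ereal" where
  "L_u P f = (SUP \<theta>\<in>{0..}. SUP x. SUP y.
     ereal \<bar>deriv (\<lambda>t. v_vec P f t $ x / v_vec P f t $ y) \<theta>\<bar>)"

end

theory Submission
  imports Defs
begin

text \<open>Write \<open>M = \<Lambda>'\<close> and \<open>g t x\<close> for the logarithmic derivative of \<open>v t x\<close>. Perron eigenvectors depend
  differentiably on the tilt, and differentiating the row sums of the tilted chain gives a Poisson
  equation for \<open>g\<close>; consequently \<open>\<Lambda>''\<close> is the variance of \<open>f y + g t y - g t x\<close> under one stationary
  step. This quantity has range at most \<open>b - a + 2 * K * L\<close>, so Popoviciu's inequality bounds
  \<open>\<Lambda>''\<close>. The relative entropy \<open>t * M t - \<Lambda> t\<close> has derivative \<open>t * \<Lambda>'' t\<close>, which is at least the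
  derivative of \<open>(M t - M 0)\<^sup>2 / (2 * s)\<close> when \<open>\<Lambda>'' \<le> s\<close> on \<open>{0..}\<close>.

  Finiteness of \<open>K\<close> and \<open>L\<close> is obtained without passing to a limit matrix: lower bounds are
  propagated along paths of edges into \<open>S_b\<close>, whose tilted probabilities stay bounded below.\<close>

subsection \<open>Perron--Frobenius theory\<close>

definition edges :: "real^'s^'s \<Rightarrow> ('s \<times> 's) set" where
  "edges A = {(x, y). 0 < A $ x $ y}"

text \<open>A positive sum of products has a positive term, and nonnegativity of \<open>A\<close> on
  \<open>T\<close> then makes both of its factors positive; this peels off the first edge of a
  path.\<close>

lemma submatrix_power_path:
  assumes "\<And>x y. x \<in> T \<Longrightarrow> y \<in> T \<Longrightarrow> 0 \<le> A $ x $ y"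
    and "x \<in> T" "y \<in> T" "0 < submatrix_power T A n x y"
  shows "(x, y) \<in> (edges A \<inter> T \<times> T) ^^ n"
  using assms(2-)
proof (induction n arbitrary: x)
  case 0
  then show ?case by (simp split: if_splits)
next
  case (Suc n)
  obtain z where z: "z \<in> T" "0 < A $ x $ z * submatrix_power T A n z y"
  proof (rule ccontr)
    assume "\<not> thesis"
    then have "(\<Sum>z\<in>T. A $ x $ z * submatrix_power T A n z y) \<le> 0"
      using that by (intro sum_nonpos) (meson not_le)
    with Suc.prems(3) show False by simp
  qed
  then have "0 < A $ x $ z" "0 < submatrix_power T A n z y"
    using assms(1)[OF Suc.prems(1) z(1)] by (auto simp: zero_less_mult_iff)
  with Suc z show ?case
    by (intro relpow_Suc_I2[of _ z]) (auto simp: edges_def)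
qed

lemma irreducible_on_trancl:
  assumes "irreducible_on T A" "x \<in> T" "y \<in> T"
  shows "(x, y) \<in> (edges A \<inter> T \<times> T)\<^sup>+"
proof -
  obtain n where "n \<ge> 1" "0 < submatrix_power T A n x y"
    using assms unfolding irreducible_on_def by blast
  moreover from this have "(x, y) \<in> (edges A \<inter> T \<times> T) ^^ n"
    using submatrix_power_path[of T A x y n] assms unfolding irreducible_on_def by blast
  ultimately show ?thesis
    by (auto simp: trancl_power intro!: exI[of _ n])
qed

section \<open>Coordinates and the probability simplex\<close>

lemma matrix_vector_mult_nth: "(A *v w) $ x = (\<Sum>y\<in>UNIV. A $ x $ y * w $ y)"
  by (simp add: matrix_vector_mult_def)

lemma vector_matrix_mult_nth: "(u v* A) $ y = (\<Sum>x\<in>UNIV. u $ x * A $ x $ y)"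
  for A :: "'a::comm_semiring_1^'n^'m"
  by (simp add: vector_matrix_mult_def mult.commute)

text \<open>Compact and convex, hence a domain for Brouwer's theorem and a compact target for the
  closed-graph criterion.\<close>

definition prob_simplex :: "(real^'s) set" where
  "prob_simplex = {w. (\<forall>x. 0 \<le> w $ x) \<and> (\<Sum>x\<in>UNIV. w $ x) = 1}"

lemma compact_prob_simplex: "compact (prob_simplex :: (real^'s) set)"
proof -
  have "w $ x \<le> 1" if "w \<in> prob_simplex" for w :: "real^'s" and x
    using that member_le_sum[of x UNIV "\<lambda>x. w $ x"] by (auto simp: prob_simplex_def)
  then have "(prob_simplex :: (real^'s) set) \<subseteq> cbox 0 1"
    by (auto simp: prob_simplex_def mem_box_cart)
  then have "bounded (prob_simplex :: (real^'s) set)"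
    using bounded_cbox bounded_subset by blast
  moreover have "closed (prob_simplex :: (real^'s) set)"
    unfolding prob_simplex_def
    by (intro closed_Collect_conj closed_Collect_all closed_Collect_le closed_Collect_eq continuous_intros)
  ultimately show ?thesis by (simp add: compact_eq_bounded_closed)
qed

lemma convex_prob_simplex: "convex (prob_simplex :: (real^'s) set)"
  unfolding prob_simplex_def
  by (auto intro!: convexI simp: sum.distrib sum_distrib_left[symmetric])

lemma prob_simplex_nonzero: "w \<in> prob_simplex \<Longrightarrow> w \<noteq> 0"
  by (auto simp: prob_simplex_def)

lemma positive_vector_nonzero: "(\<And>x. 0 < w $ x) \<Longrightarrow> w \<noteq> 0"
  for w :: "real^'s"
  by (metis less_irrefl zero_index)

lemma inner_pos_nonneg:
  fixes u z :: "real^'s"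
  assumes "\<And>x. 0 < u $ x" "\<And>x. 0 \<le> z $ x" "z \<noteq> 0"
  shows "0 < (\<Sum>x\<in>UNIV. u $ x * z $ x)"
proof -
  obtain x where "z $ x \<noteq> 0" using assms(3) by (auto simp: vec_eq_iff)
  then have "0 < u $ x * z $ x"
    using assms(1)[of x] assms(2)[of x] by auto
  then show ?thesis
    by (intro sum_pos2[of _ x]) (auto intro: mult_nonneg_nonneg less_imp_le assms)
qed

text \<open>The non-reflexive closure puts every vertex on a cycle, which excludes the
  \<open>1 x 1\<close> zero matrix.\<close>

locale irreducible_matrix =
  fixes A :: "real^'s::finite^'s"
  assumes nonneg: "0 \<le> A $ x $ y"
    and irred: "(x, y) \<in> (edges A)\<^sup>+"
begin

lemma irreducible_transpose: "irreducible_matrix (transpose A)"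
proof
  have "edges (transpose A) = (edges A)\<inverse>"
    by (auto simp: edges_def transpose_def)
  then show "(x, y) \<in> (edges (transpose A))\<^sup>+" for x y
    using irred[of y x] by (simp add: trancl_converse)
qed (simp add: transpose_def nonneg)

text \<open>Positivity travels backwards along edges: if \<open>x\<close> has an edge to
  \<open>y\<close> and \<open>w $ y\<close> is positive, so is
  \<open>(A *v w) $ x = r * w $ x\<close>.\<close>

lemma eigenvector_pos:
  assumes w: "\<And>x. 0 \<le> w $ x" "w \<noteq> 0" and eig: "A *v w = r *s w"
  shows "0 < r" "0 < w $ x"
proof -
  have step: "0 < r \<and> 0 < w $ x" if "(x, y) \<in> edges A" "0 < w $ y" for x y
  proof -
    have "0 < A $ x $ y * w $ y" using that by (simp add: edges_def)
    also have "\<dots> \<le> (\<Sum>y\<in>UNIV. A $ x $ y * w $ y)"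
      by (rule member_le_sum) (auto intro: mult_nonneg_nonneg nonneg w)
    also have "\<dots> = r * w $ x"
      using arg_cong[OF eig, of "\<lambda>v. v $ x"] by (simp add: matrix_vector_mult_nth)
    finally show ?thesis using w(1)[of x] by (auto simp: zero_less_mult_iff)
  qed
  obtain y where y: "0 < w $ y"
    using w by (metis vec_eq_iff order_le_less zero_index)
  have "0 < r \<and> 0 < w $ x"
    using irred[of x y] by (induction rule: converse_trancl_induct) (use step y in auto)
  then show "0 < r" "0 < w $ x" by auto
qed

text \<open>Brouwer's theorem, applied to \<open>A *v w\<close> rescaled to total mass one; the
  eigenvalue at a fixed point is the mass \<open>s w\<close>.\<close>

lemma eigenvector_exists:
  obtains r w where "0 < r" "\<And>x. 0 < w $ x" "A *v w = r *s w"
proof -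
  define s where "s w = (\<Sum>x\<in>UNIV. (A *v w) $ x)" for w
  have nn: "0 \<le> (A *v w) $ x" if "w \<in> prob_simplex" for w x
    using that by (auto simp: matrix_vector_mult_nth prob_simplex_def intro!: sum_nonneg mult_nonneg_nonneg nonneg)
  have pos: "0 < s w" if w: "w \<in> prob_simplex" for w
  proof -
    have "w \<noteq> 0" "\<And>x. 0 \<le> w $ x"
      using w prob_simplex_nonzero[OF w] by (auto simp: prob_simplex_def)
    then obtain y where y: "0 < w $ y"
      by (metis vec_eq_iff order_le_less zero_index)
    \<comment> \<open>The last edge of a cycle through \<open>y\<close>: no column of
      \<open>A\<close> vanishes, so the rescaling is legitimate.\<close>
    obtain x where x: "0 < A $ x $ y"
      using irred[of y y] by (auto simp: edges_def elim: tranclE)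
    have "0 < A $ x $ y * w $ y" using x y by simp
    also have "\<dots> \<le> (A *v w) $ x"
      unfolding matrix_vector_mult_nth using w
      by (intro member_le_sum) (auto simp: prob_simplex_def intro: mult_nonneg_nonneg nonneg)
    finally show ?thesis
      unfolding s_def by (intro sum_pos2[of _ x]) (auto intro: nn w)
  qed
  have "continuous_on prob_simplex (\<lambda>w. inverse (s w) *\<^sub>R (A *v w))"
    unfolding s_def
    by (intro continuous_intros linear_continuous_on linear_linear[THEN iffD2] ballI) (auto dest: pos simp: s_def)
  moreover have "(\<lambda>w. inverse (s w) *\<^sub>R (A *v w)) \<in> prob_simplex \<rightarrow> prob_simplex"
  proof
    fix w :: "real^'s" assume w: "w \<in> prob_simplex"
    have "(\<Sum>x\<in>UNIV. inverse (s w) * (A *v w) $ x) = 1"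
      using pos[OF w] by (simp flip: sum_distrib_left add: s_def)
    then show "inverse (s w) *\<^sub>R (A *v w) \<in> prob_simplex"
      using pos[OF w] nn[OF w] by (auto simp: prob_simplex_def)
  qed
  \<comment> \<open>Any vertex of the simplex serves to show that it is nonempty.\<close>
  moreover have "axis undefined 1 \<in> (prob_simplex :: (real^'s) set)"
    by (auto simp: prob_simplex_def axis_def)
  ultimately obtain w where w: "w \<in> prob_simplex" "inverse (s w) *\<^sub>R (A *v w) = w"
    using brouwer[OF compact_prob_simplex convex_prob_simplex] by blast
  have eig: "A *v w = s w *s w"
    using pos[OF w(1)] arg_cong[OF w(2), of "\<lambda>v. s w *\<^sub>R v"] by (simp add: scalar_mult_eq_scaleR)
  show thesis
  proof (rule that)
    show "0 < s w" using pos w by blast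
    show "A *v w = s w *s w" by (rule eig)
    show "0 < w $ x" for x
      using eigenvector_pos(2)[OF _ prob_simplex_nonzero[OF w(1)] eig] w by (auto simp: prob_simplex_def)
  qed
qed

lemma left_eigenvector_exists:
  obtains r u where "0 < r" "\<And>x. 0 < u $ x" "u v* A = r *s u"
  using irreducible_matrix.eigenvector_exists[OF irreducible_transpose]
  by (metis transpose_matrix_vector)

text \<open>Subtracting the largest multiple of \<open>w\<close> that leaves
  \<open>z - c *s w\<close> nonnegative produces a zero coordinate, and a nonzero nonnegative
  eigenvector has none.\<close>

lemma eigenvector_unique:
  assumes w: "\<And>x. 0 < w $ x" "A *v w = r *s w" and z: "A *v z = r *s z"
  obtains c where "z = c *s w"
proof -
  define c where "c = Min (range (\<lambda>x. z $ x / w $ x))"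
  have le: "c \<le> z $ x / w $ x" for x by (simp add: c_def)
  have ge: "0 \<le> (z - c *s w) $ x" for x using le[of x] w(1)[of x] by (simp add: pos_le_divide_eq)
  have "c \<in> range (\<lambda>x. z $ x / w $ x)" unfolding c_def by (rule Min_in) auto
  then obtain x0 where "c = z $ x0 / w $ x0" by blast
  then have "(z - c *s w) $ x0 = 0" using w(1)[of x0] by simp
  moreover have "A *v (z - c *s w) = r *s (z - c *s w)"
  proof -
    have "A *v (c *s w) = c *s (A *v w)"
      by (simp add: vec_eq_iff matrix_vector_mult_nth sum_distrib_left mult.left_commute)
    then show ?thesis
      by (simp add: matrix_vector_mult_diff_distrib w z vec_eq_iff algebra_simps)
  qed
  ultimately have "z - c *s w = 0"
    using eigenvector_pos(2)[OF ge] by (metis less_irrefl)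
  then show thesis using that[of c] by simp
qed

text \<open>Evaluating \<open>u \<bullet> (A *v z)\<close> from both sides multiplies the positive
  number \<open>u \<bullet> z\<close> by \<open>s\<close> and by \<open>r\<close>.\<close>

lemma eigenvalue_unique:
  assumes "\<And>x. 0 < u $ x" "u v* A = s *s u"
    and "\<And>x. 0 \<le> z $ x" "z \<noteq> 0" "A *v z = r *s z"
  shows "r = s"
proof -
  have "s * (u \<bullet> z) = r * (u \<bullet> z)"
    using dot_lmul_matrix[of u A z] assms by (simp add: scalar_mult_eq_scaleR)
  moreover have "0 < u \<bullet> z"
    using inner_pos_nonneg[of u z] assms by (simp add: inner_vec_def)
  ultimately show ?thesis by simp
qed

text \<open>For a complex eigenpair \<open>l\<close>, \<open>z\<close>, the triangle inequality
  bounds \<open>cmod l\<close> times the vector \<open>q\<close> of moduli by \<open>A *v q\<close>;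
  pairing with a positive left eigenvector gives \<open>cmod l \<le> r\<close>.\<close>

lemma spectral_radius_eqI:
  assumes w: "\<And>x. 0 < w $ x" "A *v w = r *s w"
  shows "spectral_radius A = r"
  unfolding spectral_radius_def
proof (rule cSup_eq_maximum)
  have r: "0 < r"
    by (rule eigenvector_pos(1)[of w]) (use w positive_vector_nonzero[of w] in \<open>auto simp: less_imp_le\<close>)
  have "map_matrix complex_of_real A *v (\<chi> x. of_real (w $ x)) = of_real r *s (\<chi> x. of_real (w $ x))"
    using w(2) by (simp add: vec_eq_iff matrix_vector_mult_nth flip: of_real_mult of_real_sum)
  moreover have "(\<chi> x. complex_of_real (w $ x)) \<noteq> 0"
    using positive_vector_nonzero[OF w(1)] by (auto simp: vec_eq_iff)
  ultimately show "r \<in> {cmod l |l. \<exists>w. w \<noteq> 0 \<and> map_matrix complex_of_real A *v w = l *s w}"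
    using r by (intro CollectI exI[of _ "complex_of_real r"] conjI) auto
next
  fix m assume "m \<in> {cmod l |l. \<exists>w. w \<noteq> 0 \<and> map_matrix complex_of_real A *v w = l *s w}"
  then obtain l z where m: "m = cmod l" and z: "z \<noteq> 0" "map_matrix complex_of_real A *v z = l *s z"
    by blast
  obtain s u where u: "\<And>x. 0 < u $ x" "u v* A = s *s u"
    using left_eigenvector_exists by metis
  have "r = s"
    by (rule eigenvalue_unique[OF u _ _ w(2)]) (use w positive_vector_nonzero[of w] in \<open>auto simp: less_imp_le\<close>)
  define q where "q = (\<chi> x. cmod (z $ x))"
  have "m * q $ x \<le> (A *v q) $ x" for x
  proof -
    have "m * q $ x = cmod (\<Sum>y\<in>UNIV. of_real (A $ x $ y) * z $ y)"
      using arg_cong[OF z(2), of "\<lambda>v. v $ x"]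
      by (simp add: m q_def matrix_vector_mult_nth norm_mult)
    also have "\<dots> \<le> (\<Sum>y\<in>UNIV. A $ x $ y * cmod (z $ y))"
      by (rule sum_norm_le) (simp add: norm_mult nonneg)
    finally show ?thesis by (simp add: matrix_vector_mult_nth q_def)
  qed
  then have "u \<bullet> (m *s q) \<le> u \<bullet> (A *v q)"
    unfolding inner_vec_def inner_real_def
    by (intro sum_mono mult_left_mono) (auto simp: less_imp_le u)
  also have "\<dots> = r * (u \<bullet> q)"
    by (simp add: \<open>r = s\<close> u scalar_mult_eq_scaleR flip: dot_lmul_matrix)
  finally have "m * (u \<bullet> q) \<le> r * (u \<bullet> q)" by (simp add: scalar_mult_eq_scaleR)
  moreover have "0 < u \<bullet> q"
    using inner_pos_nonneg[of u q] u z by (simp add: inner_vec_def q_def vec_eq_iff)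
  ultimately show "m \<le> r" by simp
qed

section \<open>Identification of the normalised Perron vectors\<close>

lemma left_eigenvalue:
  assumes "\<And>x. 0 < u $ x" "u v* A = s *s u"
  shows "spectral_radius A = s"
proof -
  obtain r w where "\<And>x. 0 < w $ x" "A *v w = r *s w"
    using eigenvector_exists by metis
  moreover from this have "r = s"
    by (intro eigenvalue_unique[OF assms, of w]) (auto simp: less_imp_le positive_vector_nonzero)
  ultimately show ?thesis using spectral_radius_eqI by metis
qed

lemma spectral_radius_pos: "0 < spectral_radius A"
  using eigenvector_exists spectral_radius_eqI by metis

text \<open>The eigenvalue \<open>s\<close> may be arbitrary, since positivity of \<open>u\<close>
  forces it to be the spectral radius.\<close>

lemma left_perron_eqI:
  assumes u: "\<And>x. 0 < u $ x" "u v* A = s *s u" "(\<Sum>x\<in>UNIV. u $ x) = 1"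
  shows "left_perron A = u"
  unfolding left_perron_def
proof (rule the_equality)
  show "(\<forall>x. 0 < u $ x) \<and> u v* A = spectral_radius A *s u \<and> (\<Sum>x\<in>UNIV. u $ x) = 1"
    using u left_eigenvalue by metis
next
  fix z assume z: "(\<forall>x. 0 < z $ x) \<and> z v* A = spectral_radius A *s z \<and> (\<Sum>x\<in>UNIV. z $ x) = 1"
  obtain c where "z = c *s u"
    using irreducible_matrix.eigenvector_unique[OF irreducible_transpose, of u s z] u z left_eigenvalue
    by (metis transpose_matrix_vector)
  with z u(3) show "z = u" by (simp flip: sum_distrib_left)
qed

lemma left_perron:
  "0 < left_perron A $ x" "left_perron A v* A = spectral_radius A *s left_perron A"
  "(\<Sum>x\<in>UNIV. left_perron A $ x) = 1"
proof -
  obtain s u where u: "\<And>x. 0 < u $ x" "u v* A = s *s u"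
    using left_eigenvector_exists by metis
  define d where "d = (\<Sum>x\<in>UNIV. u $ x)"
  have d: "0 < d" unfolding d_def by (rule sum_pos) (auto simp: u)
  define z where "z = inverse d *s u"
  have z: "\<And>x. 0 < z $ x" "(\<Sum>x\<in>UNIV. z $ x) = 1"
    using d u by (auto simp: z_def d_def[symmetric] simp flip: sum_distrib_left)
  have e: "z v* A = s *s z"
    using u(2) by (simp add: z_def vec_eq_iff vector_matrix_mult_nth mult.assoc flip: sum_distrib_left)
  have "left_perron A = z" using left_perron_eqI z e by blast
  moreover have "spectral_radius A = s" using left_eigenvalue z e by blast
  ultimately show "0 < left_perron A $ x" "left_perron A v* A = spectral_radius A *s left_perron A"
    "(\<Sum>x\<in>UNIV. left_perron A $ x) = 1" using z e by auto
qed

lemma right_perron_eqI: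
  assumes v: "\<And>x. 0 < v $ x" "A *v v = s *s v" "(\<Sum>x\<in>UNIV. left_perron A $ x * v $ x) = 1"
  shows "right_perron A = v"
  unfolding right_perron_def
proof (rule the_equality)
  show "(\<forall>x. 0 < v $ x) \<and> A *v v = spectral_radius A *s v \<and> (\<Sum>x\<in>UNIV. left_perron A $ x * v $ x) = 1"
    using v spectral_radius_eqI by metis
next
  fix z assume z: "(\<forall>x. 0 < z $ x) \<and> A *v z = spectral_radius A *s z \<and>
    (\<Sum>x\<in>UNIV. left_perron A $ x * z $ x) = 1"
  obtain c where c: "z = c *s v"
    using eigenvector_unique[of v s z] v z spectral_radius_eqI by metis
  then have "(\<Sum>x\<in>UNIV. left_perron A $ x * z $ x) = c * (\<Sum>x\<in>UNIV. left_perron A $ x * v $ x)"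
    by (simp add: sum_distrib_left mult.left_commute)
  with c z v(3) show "z = v" by simp
qed

lemma right_perron:
  "0 < right_perron A $ x" "A *v right_perron A = spectral_radius A *s right_perron A"
  "(\<Sum>x\<in>UNIV. left_perron A $ x * right_perron A $ x) = 1"
proof -
  obtain s v where v: "\<And>x. 0 < v $ x" "A *v v = s *s v"
    using eigenvector_exists by metis
  define d where "d = (\<Sum>x\<in>UNIV. left_perron A $ x * v $ x)"
  have d: "0 < d" unfolding d_def by (rule sum_pos) (auto simp: v left_perron)
  define z where "z = inverse d *s v"
  have z: "\<And>x. 0 < z $ x" using d v by (auto simp: z_def)
  have n: "(\<Sum>x\<in>UNIV. left_perron A $ x * z $ x) = 1"
    using d by (simp add: z_def mult.left_commute[of _ "inverse d"] d_def[symmetric] flip: sum_distrib_left)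
  have e: "A *v z = s *s z"
    using v(2) by (simp add: z_def vec_eq_iff matrix_vector_mult_nth mult.left_commute[of _ "inverse d"]
        flip: sum_distrib_left)
  have "right_perron A = z" using right_perron_eqI z e n by blast
  moreover have "spectral_radius A = s" using spectral_radius_eqI z e by blast
  ultimately show "0 < right_perron A $ x" "A *v right_perron A = spectral_radius A *s right_perron A"
    "(\<Sum>x\<in>UNIV. left_perron A $ x * right_perron A $ x) = 1" using z e n by auto
qed

end

subsection \<open>Differentiable families of irreducible matrices\<close>

text \<open>Only the matrix entries are assumed differentiable; regularity of \<open>p\<close> and
  \<open>r\<close> is derived. The unit-mass normalisation lets the locale serve right eigenvectors
  and, via transposes, left ones.\<close>

locale irreducible_family =
  fixes A A' :: "real \<Rightarrow> real^'s::finite^'s" and p :: "real \<Rightarrow> real^'s" and r :: "real \<Rightarrow> real"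
  assumes irreducible: "irreducible_matrix (A t)"
    and deriv_entry: "((\<lambda>s. A s $ x $ y) has_real_derivative A' t $ x $ y) (at t)"
    and p_pos: "0 < p t $ x"
    and p_sum: "(\<Sum>x\<in>UNIV. p t $ x) = 1"
    and eigen: "A t *v p t = r t *s p t"
begin

lemma p_simplex: "p t \<in> prob_simplex"
  by (simp add: prob_simplex_def p_sum less_imp_le p_pos)

lemma spectral_radius_family: "spectral_radius (A t) = r t"
  using irreducible_matrix.spectral_radius_eqI[OF irreducible p_pos eigen] .

text \<open>A map into a compact set is continuous if its graph is closed, and uniqueness of the
  Perron vector describes the graph by closed conditions.\<close>

lemma continuous_eigenvector: "continuous_on UNIV p"
proof (rule continuous_from_closed_graph[OF compact_prob_simplex])
  \<comment> \<open>On the simplex the eigenvalue is the total mass of the image, so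
    \<open>G\<close> avoids \<open>r\<close>, whose continuity is not yet available.\<close>
  define G where "G = {z. snd z \<in> prob_simplex \<and>
    (\<forall>x. (A (fst z) *v snd z) $ x = (\<Sum>x\<in>UNIV. (A (fst z) *v snd z) $ x) * snd z $ x)}"
  have contA: "continuous_on UNIV (\<lambda>t. A t $ x $ y)" for x y
    by (auto intro!: continuous_at_imp_continuous_on DERIV_isCont deriv_entry)
  have cont: "continuous_on UNIV (\<lambda>z::real \<times> (real^'s). A (fst z) $ x $ y)" for x y
    by (rule continuous_on_compose2[OF contA]) (auto intro: continuous_intros)
  have "closed (snd -` prob_simplex :: (real \<times> (real^'s)) set)"
    by (intro closed_vimage compact_imp_closed compact_prob_simplex continuous_intros)
  then have "closed G"
    unfolding G_def matrix_vector_mult_nth vimage_def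
    by (intro closed_Collect_conj closed_Collect_all closed_Collect_eq continuous_intros cont)
  moreover have "(\<lambda>t. (t, p t)) ` UNIV = G"
  proof
    have "(\<Sum>x\<in>UNIV. (A t *v p t) $ x) = r t" for t
      by (simp add: eigen p_sum flip: sum_distrib_left)
    then show "(\<lambda>t. (t, p t)) ` UNIV \<subseteq> G"
      by (auto simp: G_def p_simplex eigen)
  next
    show "G \<subseteq> (\<lambda>t. (t, p t)) ` UNIV"
    proof
      fix z :: "real \<times> (real^'s)" assume "z \<in> G"
      obtain t q where z: "z = (t, q)" by (cases z)
      have q: "q \<in> prob_simplex"
        and eq: "\<And>x. (A t *v q) $ x = (\<Sum>x\<in>UNIV. (A t *v q) $ x) * q $ x"
        using \<open>z \<in> G\<close> unfolding G_def z fst_conv snd_conv mem_Collect_eq by blast+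
      interpret irreducible_matrix "A t" by (rule irreducible)
      define s where "s = (\<Sum>x\<in>UNIV. (A t *v q) $ x)"
      have eig: "A t *v q = s *s q"
        unfolding vec_eq_iff s_def vector_smult_component using eq by blast
      have qpos: "0 < q $ x" for x
        using eigenvector_pos(2)[OF _ prob_simplex_nonzero[OF q] eig] q by (auto simp: prob_simplex_def)
      have "s = r t"
        using spectral_radius_eqI[OF qpos eig] spectral_radius_family by simp
      with eig have "A t *v q = r t *s q" by simp
      then obtain c where c: "q = c *s p t"
        using eigenvector_unique[OF p_pos eigen] by blast
      have "(\<Sum>x\<in>UNIV. q $ x) = 1" using q by (simp add: prob_simplex_def)
      then have "q = p t" using c p_sum by (simp flip: sum_distrib_left)
      then show "z \<in> (\<lambda>t. (t, p t)) ` UNIV" by (simp add: z)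
    qed
  qed
  ultimately show "closed ((\<lambda>t. (t, p t)) ` UNIV)" by simp
qed (simp add: p_simplex)

lemma tendsto_eigenvector: "(p \<longlongrightarrow> p t) (at t)"
  using continuous_eigenvector by (simp add: continuous_on_def)

lemma tendsto_diff_quotient: "((\<lambda>s. (A s $ x $ y - A t $ x $ y) / (s - t)) \<longlongrightarrow> A' t $ x $ y) (at t)"
  using deriv_entry[of x y t] by (simp add: has_field_derivative_iff)

lemma inner_left_eigenvector:
  assumes "u v* A t = r t *s u"
  shows "u \<bullet> (A t *v w) = r t * (u \<bullet> w)"
  by (simp add: assms scalar_mult_eq_scaleR flip: dot_lmul_matrix)

text \<open>Testing \<open>(A s - A t) p s\<close> against the left eigenvector at \<open>t\<close> gives
  \<open>(r s - r t) (u \<bullet> p s)\<close>, so continuity of \<open>p\<close> suffices.\<close>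

lemma eigenvalue_deriv:
  assumes u: "\<And>x. 0 < u $ x" "u v* A t = r t *s u"
  shows "(r has_real_derivative
    (\<Sum>x\<in>UNIV. \<Sum>y\<in>UNIV. u $ x * A' t $ x $ y * p t $ y) / (u \<bullet> p t)) (at t)"
proof -
  have pos: "0 < u \<bullet> p s" for s
    using inner_pos_nonneg[of u "p s"] u p_pos positive_vector_nonzero[of "p s"]
    by (simp add: inner_vec_def less_imp_le)
  have eq: "(r s - r t) / (s - t) =
    (\<Sum>x\<in>UNIV. \<Sum>y\<in>UNIV. u $ x * ((A s $ x $ y - A t $ x $ y) / (s - t)) * p s $ y) / (u \<bullet> p s)"
    for s
  proof -
    have "(r s - r t) * (u \<bullet> p s) = u \<bullet> (A s *v p s) - u \<bullet> (A t *v p s)"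
      using inner_left_eigenvector[OF u(2)] by (simp add: eigen scalar_mult_eq_scaleR algebra_simps)
    also have "\<dots> = (\<Sum>x\<in>UNIV. \<Sum>y\<in>UNIV. u $ x * (A s $ x $ y - A t $ x $ y) * p s $ y)"
      by (simp add: inner_vec_def matrix_vector_mult_nth sum_distrib_left algebra_simps
          flip: sum_subtractf)
    finally have "(r s - r t) * (u \<bullet> p s) / (s - t) =
      (\<Sum>x\<in>UNIV. \<Sum>y\<in>UNIV. u $ x * ((A s $ x $ y - A t $ x $ y) / (s - t)) * p s $ y)"
      by (simp add: sum_divide_distrib)
    then show ?thesis using pos[of s] by (simp add: field_simps)
  qed
  have "((\<lambda>s. u \<bullet> p s) \<longlongrightarrow> u \<bullet> p t) (at t)"
    unfolding inner_vec_def by (intro tendsto_intros tendsto_eigenvector)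
  then show ?thesis
    unfolding has_field_derivative_iff eq using pos[of t]
    by (intro tendsto_intros tendsto_diff_quotient tendsto_eigenvector) auto
qed

lemma left_eigenvector:
  obtains u where "\<And>x. 0 < u $ x" "u v* A t = r t *s u"
  using irreducible_matrix.left_perron[OF irreducible] spectral_radius_family by metis

text \<open>The difference quotient of \<open>p\<close> solves a linear system with fixed invertible
  matrix and convergent right-hand side.\<close>

lemma eigenvector_differentiable:
  "\<exists>D. ((\<lambda>s. p s $ x) has_real_derivative D) (at t)"
proof -
  interpret irreducible_matrix "A t" by (rule irreducible)
  obtain u where u: "\<And>x. 0 < u $ x" "u v* A t = r t *s u"
    using left_eigenvector by blast
  \<comment> \<open>\<open>A t - r t\<close> is singular exactly along \<open>p t\<close>; the
    rank-one term repairs this and vanishes on \<open>p s - p t\<close>, whose mass is zero.\<close>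
  define B where "B w = A t *v w - r t *s w + (\<Sum>x\<in>UNIV. w $ x) *s p t" for w
  have lin: "linear B"
    unfolding B_def
    by (rule linearI) (simp_all add: vec_eq_iff matrix_vector_right_distrib matrix_vector_mult_scaleR
        sum.distrib algebra_simps flip: sum_distrib_left)
  have "w = 0" if w: "B w = 0" for w
  proof -
    have "(\<Sum>x\<in>UNIV. w $ x) * (u \<bullet> p t) = 0"
      using arg_cong[OF w, of "\<lambda>z. u \<bullet> z"] inner_left_eigenvector[OF u(2), of w]
      by (simp add: B_def inner_add_right inner_diff_right scalar_mult_eq_scaleR)
    moreover have "0 < u \<bullet> p t"
      using inner_pos_nonneg[of u "p t"] u p_pos positive_vector_nonzero[of "p t"]
      by (simp add: inner_vec_def less_imp_le)
    ultimately have s: "(\<Sum>x\<in>UNIV. w $ x) = 0" by simp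
    with w have "A t *v w = r t *s w" by (simp add: B_def)
    then obtain c where "w = c *s p t"
      using eigenvector_unique[OF p_pos eigen] by blast
    with s p_sum show "w = 0" by (simp flip: sum_distrib_left)
  qed
  then have "inj B" using lin by (simp add: linear_injective_0)
  then obtain C where C: "linear C" "C \<circ> B = id"
    using linear_injective_left_inverse[OF lin] by blast
  \<comment> \<open>Dividing \<open>B (p s - p t)\<close> by \<open>s - t\<close> gives this vector;
    its limit needs only continuity of \<open>p\<close> and the derivative of
    \<open>r\<close>.\<close>
  define R where "R s = (\<chi> x. (r s - r t) / (s - t) * p s $ x
    - (\<Sum>y\<in>UNIV. (A s $ x $ y - A t $ x $ y) / (s - t) * p s $ y))" for s
  obtain r' where r': "(r has_real_derivative r') (at t)"
    using eigenvalue_deriv[OF u] by blast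
  define l where "l = (\<chi> x. r' * p t $ x - (\<Sum>y\<in>UNIV. A' t $ x $ y * p t $ y))"
  have "(R \<longlongrightarrow> l) (at t)"
    unfolding R_def l_def
    by (intro tendsto_vec_lambda tendsto_intros tendsto_diff_quotient tendsto_eigenvector
        r'[unfolded has_field_derivative_iff])
  then have "((\<lambda>s. C (R s)) \<longlongrightarrow> C l) (at t)"
    by (intro bounded_linear.tendsto[OF linear_conv_bounded_linear[THEN iffD1, OF C(1)]])
  then have lim: "((\<lambda>s. C (R s) $ x) \<longlongrightarrow> C l $ x) (at t)" by (rule tendsto_vec_nth)
  have "C (R s) $ x = (p s $ x - p t $ x) / (s - t)" if "s \<noteq> t" for s
  proof -
    have "B (p s - p t) = A t *v p s - r t *s p s"
      by (simp add: B_def matrix_vector_mult_diff_distrib eigen sum_subtractf p_sum vec_eq_iff algebra_simps)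
    also have "\<dots> = (s - t) *\<^sub>R R s"
    proof -
      have "(A t *v p s) $ x = r s * p s $ x - (\<Sum>y\<in>UNIV. (A s $ x $ y - A t $ x $ y) * p s $ y)" for x
        using arg_cong[OF eigen[of s], of "\<lambda>z. z $ x"]
        by (simp add: matrix_vector_mult_nth sum_subtractf left_diff_distrib)
      then show ?thesis
        using that by (simp add: vec_eq_iff R_def sum_distrib_left right_diff_distrib)
          (simp add: algebra_simps)
    qed
    finally have "C (B (p s - p t)) = (s - t) *\<^sub>R C (R s)"
      using C(1) by (simp add: linear_cmul)
    moreover have "C (B (p s - p t)) = p s - p t" using C(2) by (metis comp_apply id_apply)
    ultimately have "p s - p t = (s - t) *\<^sub>R C (R s)" by simp
    from arg_cong[OF this, of "\<lambda>z. z $ x"] have "p s $ x - p t $ x = (s - t) * C (R s) $ x"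
      by simp
    then show ?thesis using that by simp
  qed
  then have "((\<lambda>s. (p s $ x - p t $ x) / (s - t)) \<longlongrightarrow> C l $ x) (at t)"
    using lim by (elim Lim_transform_eventually) (auto simp: eventually_at_filter)
  then show ?thesis by (auto simp: has_field_derivative_iff)
qed

end

subsection \<open>The tilted chains\<close>

locale irreducible_chain =
  fixes P :: "real^'s::finite^'s" and f :: "'s \<Rightarrow> real"
  assumes stochastic: "stochastic_matrix P"
    and irreducible_P: "irreducible_on UNIV P"
begin

abbreviation "\<rho> \<equiv> rho P f"
abbreviation "\<Lambda> \<equiv> Lambda P f"
abbreviation "u t x \<equiv> u_vec P f t $ x"
abbreviation "v t x \<equiv> v_vec P f t $ x"
abbreviation "Q t x y \<equiv> tilted_chain P f t $ x $ y"
abbreviation "\<pi> t x \<equiv> tilted_stationary P f t $ x"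
abbreviation "M t \<equiv> mean (tilted_stationary P f t) f"

lemma P_nonneg: "0 \<le> P $ x $ y"
  and P_row_sum: "(\<Sum>y\<in>UNIV. P $ x $ y) = 1"
  using stochastic by (auto simp: stochastic_matrix_def)

lemma irreducible_tilted: "irreducible_matrix (tilted P f t)"
proof
  have "edges (tilted P f t) = edges P"
    by (auto simp: edges_def tilted_def zero_less_mult_iff)
  then show "(x, y) \<in> (edges (tilted P f t))\<^sup>+" for x y
    using irreducible_on_trancl[OF irreducible_P, of x y] by simp
qed (simp add: tilted_def P_nonneg)

lemma tilted_0: "tilted P f 0 = P"
  by (simp add: tilted_def)

lemma rho_pos: "0 < \<rho> t"
  unfolding rho_def by (rule irreducible_matrix.spectral_radius_pos[OF irreducible_tilted])

lemma u_pos: "0 < u t x" and u_sum: "(\<Sum>x\<in>UNIV. u t x) = 1"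
  and u_eigen: "u_vec P f t v* tilted P f t = \<rho> t *s u_vec P f t"
  unfolding u_vec_def rho_def by (intro irreducible_matrix.left_perron[OF irreducible_tilted])+

lemma v_pos: "0 < v t x" and uv_sum: "(\<Sum>x\<in>UNIV. u t x * v t x) = 1"
  and v_eigen: "tilted P f t *v v_vec P f t = \<rho> t *s v_vec P f t"
  unfolding u_vec_def v_vec_def rho_def by (intro irreducible_matrix.right_perron[OF irreducible_tilted])+

lemma u_sum_eq: "(\<Sum>x\<in>UNIV. u t x * (P $ x $ y * exp (t * f y))) = \<rho> t * u t y"
  using arg_cong[OF u_eigen, of "\<lambda>z. z $ y"] by (simp add: vector_matrix_mult_nth tilted_def)

lemma v_sum_eq: "(\<Sum>y\<in>UNIV. P $ x $ y * exp (t * f y) * v t y) = \<rho> t * v t x"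
  using arg_cong[OF v_eigen, of "\<lambda>z. z $ x"] by (simp add: matrix_vector_mult_nth tilted_def)

section \<open>Differentiability of the Perron vectors in the tilt\<close>

definition tilted_deriv :: "real \<Rightarrow> real^'s^'s" where
  "tilted_deriv t = (\<chi> x y. P $ x $ y * (f y * exp (t * f y)))"

definition v_normed :: "real \<Rightarrow> real^'s" where
  "v_normed t = inverse (\<Sum>x\<in>UNIV. v t x) *s v_vec P f t"

lemma v_total_pos: "0 < (\<Sum>x\<in>UNIV. v t x)"
  by (rule sum_pos) (auto simp: v_pos)

lemma tilted_has_derivative:
  "((\<lambda>s. tilted P f s $ x $ y) has_real_derivative tilted_deriv t $ x $ y) (at t)"
  unfolding tilted_def tilted_deriv_def
  by (auto intro!: derivative_eq_intros)

sublocale right: irreducible_family "tilted P f" tilted_deriv v_normed \<rho>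
proof (rule irreducible_family.intro)
  fix t
  have "v_normed t = inverse (\<Sum>x\<in>UNIV. v t x) *\<^sub>R v_vec P f t"
    by (simp add: v_normed_def scalar_mult_eq_scaleR)
  then show "tilted P f t *v v_normed t = \<rho> t *s v_normed t"
    by (simp add: matrix_vector_mult_scaleR v_eigen) (simp add: vec_eq_iff)
  show "(\<Sum>x\<in>UNIV. v_normed t $ x) = 1"
    using v_total_pos[of t] by (simp add: v_normed_def flip: sum_distrib_left)
qed (use v_total_pos in \<open>auto simp: irreducible_tilted tilted_has_derivative v_normed_def v_pos\<close>)

sublocale left: irreducible_family "\<lambda>t. transpose (tilted P f t)" "\<lambda>t. transpose (tilted_deriv t)"
  "u_vec P f" \<rho>
proof (rule irreducible_family.intro)
  show "transpose (tilted P f t) *v u_vec P f t = \<rho> t *s u_vec P f t" for t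
    by (simp add: transpose_matrix_vector u_eigen)
  show "((\<lambda>s. transpose (tilted P f s) $ x $ y) has_real_derivative transpose (tilted_deriv t) $ x $ y) (at t)"
    for x y t
    using tilted_has_derivative[of y x t] by (simp add: transpose_def)
qed (auto simp: irreducible_matrix.irreducible_transpose irreducible_tilted u_pos u_sum)

lemma u_differentiable: "\<exists>D. ((\<lambda>s. u s x) has_real_derivative D) (at t)"
  by (rule left.eigenvector_differentiable)

text \<open>Recovers the normalisation against \<open>u_vec\<close> from the unit-mass one, so that
  differentiability carries over.\<close>

lemma v_eq: "v t x = v_normed t $ x / (\<Sum>x\<in>UNIV. u t x * v_normed t $ x)"
proof -
  have "(\<Sum>x\<in>UNIV. u t x * v_normed t $ x) = inverse (\<Sum>x\<in>UNIV. v t x)"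
    by (simp add: v_normed_def uv_sum mult.left_commute[of "u t _"] flip: sum_distrib_left)
  then show ?thesis using v_total_pos[of t] by (simp add: v_normed_def)
qed

lemma v_differentiable: "\<exists>D. ((\<lambda>s. v s x) has_real_derivative D) (at t)"
proof -
  have "\<forall>x. \<exists>D. ((\<lambda>s. u s x) has_real_derivative D) (at t)"
    using u_differentiable by blast
  then obtain u' where u': "\<And>x. ((\<lambda>s. u s x) has_real_derivative u' x) (at t)" by metis
  have "\<forall>x. \<exists>D. ((\<lambda>s. v_normed s $ x) has_real_derivative D) (at t)"
    using right.eigenvector_differentiable by blast
  then obtain q' where q': "\<And>x. ((\<lambda>s. v_normed s $ x) has_real_derivative q' x) (at t)" by metis
  have "(\<Sum>x\<in>UNIV. u t x * v_normed t $ x) \<noteq> 0"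
    using v_eq[of t x] v_pos[of t x] by auto
  moreover have "((\<lambda>s. \<Sum>x\<in>UNIV. u s x * v_normed s $ x) has_real_derivative
      (\<Sum>x\<in>UNIV. u' x * v_normed t $ x + q' x * u t x)) (at t)"
    by (intro DERIV_sum DERIV_mult u' q')
  ultimately show ?thesis
    unfolding v_eq[abs_def] using DERIV_divide[OF q'] by blast
qed

definition g :: "real \<Rightarrow> 's \<Rightarrow> real" where
  "g t x = deriv (\<lambda>s. v s x) t / v t x"

lemma v_deriv: "((\<lambda>s. v s x) has_real_derivative v t x * g t x) (at t)"
proof -
  obtain D where D: "((\<lambda>s. v s x) has_real_derivative D) (at t)" using v_differentiable by blast
  then have "v t x * g t x = D" using v_pos[of t x] by (simp add: g_def DERIV_imp_deriv)
  with D show ?thesis by simp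
qed

section \<open>The tilted chain and its stationary distribution\<close>

lemma Q_eq: "Q t x y = P $ x $ y * exp (t * f y) * v t y / (\<rho> t * v t x)"
  by (simp add: tilted_chain_def tilted_def)

lemma Q_nonneg: "0 \<le> Q t x y"
  using v_pos[of t x] v_pos[of t y] rho_pos[of t]
  by (auto simp: Q_eq P_nonneg intro!: divide_nonneg_pos mult_nonneg_nonneg)

lemma Q_pos_iff: "0 < Q t x y \<longleftrightarrow> 0 < P $ x $ y"
proof -
  have "Q t x y = P $ x $ y * (exp (t * f y) * v t y / (\<rho> t * v t x))" by (simp add: Q_eq)
  moreover have "0 < exp (t * f y) * v t y / (\<rho> t * v t x)" by (simp add: v_pos rho_pos)
  ultimately show ?thesis by (metis zero_less_mult_pos2 mult_pos_pos)
qed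

lemma Q_row_sum: "(\<Sum>y\<in>UNIV. Q t x y) = 1"
  using v_pos[of t x] rho_pos[of t] by (simp add: Q_eq v_sum_eq flip: sum_divide_distrib)

lemma stationary_eq: "\<pi> t x = u t x * v t x"
  by (simp add: tilted_stationary_def)

lemma stationary_pos: "0 < \<pi> t x"
  by (simp add: stationary_eq u_pos v_pos)

lemma stationary_sum: "(\<Sum>x\<in>UNIV. \<pi> t x) = 1"
  by (simp add: stationary_eq uv_sum)

lemma stationary: "(\<Sum>x\<in>UNIV. \<pi> t x * Q t x y) = \<pi> t y"
proof -
  have "\<pi> t x * Q t x y = u t x * (P $ x $ y * exp (t * f y)) * (v t y / \<rho> t)" for x
    using v_pos[of t x] by (simp add: stationary_eq Q_eq)
  then have "(\<Sum>x\<in>UNIV. \<pi> t x * Q t x y) = \<rho> t * u t y * (v t y / \<rho> t)"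
    by (simp only: u_sum_eq flip: sum_distrib_right)
  then show ?thesis using rho_pos[of t] by (simp add: stationary_eq)
qed

lemma expect_source: "(\<Sum>x\<in>UNIV. \<Sum>y\<in>UNIV. \<pi> t x * Q t x y * \<phi> x) = (\<Sum>x\<in>UNIV. \<pi> t x * \<phi> x)"
proof -
  have "(\<Sum>y\<in>UNIV. \<pi> t x * Q t x y * \<phi> x) = \<pi> t x * \<phi> x * (\<Sum>y\<in>UNIV. Q t x y)" for x
    by (simp add: sum_distrib_left mult_ac)
  then show ?thesis by (simp add: Q_row_sum)
qed

lemma expect_target: "(\<Sum>x\<in>UNIV. \<Sum>y\<in>UNIV. \<pi> t x * Q t x y * \<phi> y) = (\<Sum>x\<in>UNIV. \<pi> t x * \<phi> x)"
  by (subst sum.swap) (simp add: stationary flip: sum_distrib_right)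

text \<open>The coboundary \<open>\<phi> y - \<phi> x\<close> has mean zero under a stationary
  step.\<close>

lemma expect_increment:
  "(\<Sum>x\<in>UNIV. \<Sum>y\<in>UNIV. \<pi> t x * Q t x y * (f y + \<phi> y - \<phi> x)) = M t"
proof -
  have "M t = (\<Sum>x\<in>UNIV. \<pi> t x * f x)" by (simp add: mean_def mult.commute)
  then show ?thesis
    using expect_source[of t \<phi>] expect_target[of t \<phi>] expect_target[of t f]
    by (simp add: distrib_left right_diff_distrib sum.distrib sum_subtractf)
qed

section \<open>Derivatives of the log-spectral radius\<close>

lemma rho_deriv: "(\<rho> has_real_derivative \<rho> t * M t) (at t)"
proof -
  define c where "c = inverse (\<Sum>x\<in>UNIV. v t x)"
  have c: "c \<noteq> 0" using v_total_pos[of t] by (simp add: c_def)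
  have n: "v_normed t $ x = c * v t x" for x by (simp add: v_normed_def c_def)
  have "u_vec P f t \<bullet> v_normed t = c"
    by (simp add: inner_vec_def n uv_sum mult.left_commute[of _ c] flip: sum_distrib_left)
  moreover have "(\<Sum>x\<in>UNIV. \<Sum>y\<in>UNIV. u t x * tilted_deriv t $ x $ y * v_normed t $ y) = c * (\<rho> t * M t)"
  proof -
    \<comment> \<open>Summing over \<open>x\<close> first allows the left eigenvector equation to be
      applied.\<close>
    have "(\<Sum>x\<in>UNIV. u t x * tilted_deriv t $ x $ y * v_normed t $ y)
        = (\<Sum>x\<in>UNIV. u t x * (P $ x $ y * exp (t * f y))) * (f y * v_normed t $ y)" for y
      unfolding tilted_deriv_def sum_distrib_right by (intro sum.cong refl) (simp add: mult_ac)
    also have "\<dots> y = c * (\<rho> t * (f y * \<pi> t y))" for y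
      unfolding u_sum_eq by (simp add: n stationary_eq)
    finally show ?thesis
      by (subst sum.swap) (simp add: mean_def flip: sum_distrib_left)
  qed
  ultimately show ?thesis
    using right.eigenvalue_deriv[OF u_pos u_eigen, of t] c by simp
qed

lemma Lambda_deriv: "(\<Lambda> has_real_derivative M t) (at t)"
  unfolding Lambda_def[abs_def] using rho_pos[of t]
  by (auto intro!: derivative_eq_intros rho_deriv)

lemma deriv_Lambda: "deriv \<Lambda> = M"
  using Lambda_deriv DERIV_imp_deriv by blast

text \<open>Obtained by differentiating both sides of the right eigenvector equation and dividing by
  \<open>\<rho> t * v t x\<close>.\<close>

lemma poisson_equation: "(\<Sum>y\<in>UNIV. Q t x y * (f y + g t y - g t x)) = M t"
proof -
  have "((\<lambda>s. \<Sum>y\<in>UNIV. P $ x $ y * exp (s * f y) * v s y) has_real_derivative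
      (\<Sum>y\<in>UNIV. P $ x $ y * exp (t * f y) * v t y * (f y + g t y))) (at t)"
    by (rule DERIV_sum) (auto intro!: derivative_eq_intros v_deriv simp: algebra_simps)
  moreover have "((\<lambda>s. \<rho> s * v s x) has_real_derivative \<rho> t * v t x * (M t + g t x)) (at t)"
    by (auto intro!: derivative_eq_intros v_deriv rho_deriv simp: algebra_simps)
  ultimately have "(\<Sum>y\<in>UNIV. P $ x $ y * exp (t * f y) * v t y * (f y + g t y)) = \<rho> t * v t x * (M t + g t x)"
    unfolding v_sum_eq by (rule DERIV_unique)
  then have "(\<Sum>y\<in>UNIV. Q t x y * (f y + g t y)) = M t + g t x"
    using rho_pos[of t] v_pos[of t x] by (simp add: Q_eq flip: sum_divide_distrib)
  moreover have "(\<Sum>y\<in>UNIV. Q t x y * g t x) = g t x"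
    by (simp add: Q_row_sum flip: sum_distrib_right)
  ultimately show ?thesis by (simp add: right_diff_distrib sum_subtractf)
qed

text \<open>The score of the tilted chain: on edges, the logarithmic derivative of
  \<open>Q t x y\<close> in \<open>t\<close>.\<close>

definition h :: "real \<Rightarrow> 's \<Rightarrow> 's \<Rightarrow> real" where
  "h t x y = f y + g t y - g t x - M t"

lemma Q_deriv: "((\<lambda>s. Q s x y) has_real_derivative Q t x y * h t x y) (at t)"
  unfolding Q_eq using rho_pos[of t] v_pos[of t x] v_pos[of t y]
  by (auto intro!: derivative_eq_intros v_deriv rho_deriv simp: h_def field_simps power2_eq_square)

lemma h_mean_zero: "(\<Sum>y\<in>UNIV. Q t x y * h t x y) = 0"
proof -
  have "(\<Sum>y\<in>UNIV. Q t x y * h t x y) = (\<Sum>y\<in>UNIV. Q t x y * (f y + g t y - g t x)) - M t * (\<Sum>y\<in>UNIV. Q t x y)"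
    by (simp add: h_def right_diff_distrib sum_subtractf sum_distrib_left mult.commute)
  then show ?thesis by (simp add: poisson_equation Q_row_sum)
qed

lemma stationary_differentiable: "\<exists>D. ((\<lambda>s. \<pi> s x) has_real_derivative D) (at t)"
proof -
  obtain D where "((\<lambda>s. u s x) has_real_derivative D) (at t)" using u_differentiable by blast
  from DERIV_mult[OF this v_deriv] show ?thesis unfolding stationary_eq by blast
qed

text \<open>As \<open>h\<close> has conditional mean zero, this is the variance of
  \<open>f y + g t y - g t x\<close> over a stationary step; it turns out to be
  \<open>\<Lambda>''\<close>.\<close>

definition W :: "real \<Rightarrow> real" where
  "W t = (\<Sum>x\<in>UNIV. \<Sum>y\<in>UNIV. \<pi> t x * Q t x y * (h t x y)\<^sup>2)"

text \<open>Freezing \<open>g\<close> at \<open>t\<close> writes \<open>M s\<close> as the expectation of \<open>f y + g t y - g t x\<close>, whose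
  conditional mean at \<open>s = t\<close> is constant in \<open>x\<close>; the unknown derivative of the stationary
  distribution therefore drops out.\<close>

lemma mean_deriv: "(M has_real_derivative W t) (at t)"
proof -
  have "\<forall>x. \<exists>D. ((\<lambda>s. \<pi> s x) has_real_derivative D) (at t)"
    using stationary_differentiable by blast
  then obtain \<pi>' where \<pi>': "\<And>x. ((\<lambda>s. \<pi> s x) has_real_derivative \<pi>' x) (at t)" by metis
  have "((\<lambda>s. \<Sum>x\<in>UNIV. \<pi> s x) has_real_derivative (\<Sum>x\<in>UNIV. \<pi>' x)) (at t)"
    by (intro DERIV_sum \<pi>')
  then have sum0: "(\<Sum>x\<in>UNIV. \<pi>' x) = 0"
    unfolding stationary_sum using DERIV_const DERIV_unique by blast
  have "((\<lambda>s. \<Sum>x\<in>UNIV. \<Sum>y\<in>UNIV. \<pi> s x * Q s x y * (f y + g t y - g t x)) has_real_derivative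
    (\<Sum>x\<in>UNIV. \<Sum>y\<in>UNIV. (\<pi>' x * Q t x y + Q t x y * h t x y * \<pi> t x) * (f y + g t y - g t x))) (at t)"
    by (intro DERIV_sum DERIV_cmult_right DERIV_mult \<pi>' Q_deriv)
  moreover have "(\<Sum>y\<in>UNIV. (\<pi>' x * Q t x y + Q t x y * h t x y * \<pi> t x) * (f y + g t y - g t x))
     = \<pi>' x * M t + (\<Sum>y\<in>UNIV. \<pi> t x * Q t x y * (h t x y)\<^sup>2)" for x
  proof -
    have "(\<Sum>y\<in>UNIV. (\<pi>' x * Q t x y + Q t x y * h t x y * \<pi> t x) * (f y + g t y - g t x))
      = (\<Sum>y\<in>UNIV. \<pi>' x * (Q t x y * (f y + g t y - g t x)) + \<pi> t x * M t * (Q t x y * h t x y)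
          + \<pi> t x * Q t x y * (h t x y)\<^sup>2)"
      by (intro sum.cong) (auto simp: h_def power2_eq_square algebra_simps)
    also have "\<dots> = \<pi>' x * M t + (\<Sum>y\<in>UNIV. \<pi> t x * Q t x y * (h t x y)\<^sup>2)"
      by (simp only: sum.distrib sum_distrib_left[symmetric] poisson_equation h_mean_zero mult_zero_right add_0_right)
    finally show ?thesis .
  qed
  ultimately show ?thesis
    by (simp add: expect_increment sum.distrib sum0 W_def flip: sum_distrib_right)
qed

lemma deriv_mean: "deriv M = W"
  using mean_deriv DERIV_imp_deriv by blast

lemma ratio_deriv:
  "((\<lambda>s. v s x / v s y) has_real_derivative v t x / v t y * (g t x - g t y)) (at t)"
  using v_pos[of t y] v_pos[of t x]
  by (auto intro!: derivative_eq_intros v_deriv simp: field_simps power2_eq_square)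

text \<open>On edges the log-ratio is \<open>(t - s) * f y\<close> plus a constant plus a
  coboundary, which stationarity removes.\<close>

lemma rel_entropy_rate_eq:
  "rel_entropy_rate P f t s = (t - s) * M t - \<Lambda> t + \<Lambda> s"
proof -
  define \<phi> where "\<phi> x = ln (v t x) - ln (v s x)" for x
  have eq: "Q t x y * ln (Q t x y / Q s x y) = Q t x y * ((t - s) * f y + (\<phi> y - \<phi> x) + (\<Lambda> s - \<Lambda> t))" for x y
  proof (cases "P $ x $ y = 0")
    case False
    then have p: "0 < P $ x $ y" using P_nonneg[of x y] by simp
    have "ln (Q t x y / Q s x y) = (t - s) * f y + (\<phi> y - \<phi> x) + (\<Lambda> s - \<Lambda> t)"
      using p v_pos[of t x] v_pos[of t y] v_pos[of s x] v_pos[of s y] rho_pos[of t] rho_pos[of s]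
      by (simp add: Q_eq ln_div ln_mult \<phi>_def Lambda_def algebra_simps)
    then show ?thesis by simp
  qed (simp add: Q_eq)
  have "rel_entropy_rate P f t s = (\<Sum>x\<in>UNIV. \<Sum>y\<in>UNIV.
     (t - s) * (\<pi> t x * Q t x y * f y) + \<pi> t x * Q t x y * \<phi> y - \<pi> t x * Q t x y * \<phi> x
       + \<pi> t x * Q t x y * (\<Lambda> s - \<Lambda> t))"
    unfolding rel_entropy_rate_def by (intro sum.cong refl) (simp only: mult.assoc eq, simp add: algebra_simps)
  also have "\<dots> = (t - s) * (\<Sum>x\<in>UNIV. \<pi> t x * f x) + (\<Lambda> s - \<Lambda> t)"
    by (simp only: sum.distrib sum_subtractf sum_distrib_left[symmetric] expect_source expect_target)
      (simp add: stationary_sum flip: sum_distrib_right)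
  finally show ?thesis by (simp add: mean_def mult.commute)
qed

section \<open>The chain at tilt zero\<close>

interpretation P: irreducible_matrix P
  using irreducible_tilted[of 0] by (simp add: tilted_0)

lemma rho_0: "\<rho> 0 = 1"
  unfolding rho_def tilted_0
  by (rule P.spectral_radius_eqI[of 1]) (simp_all add: vec_eq_iff matrix_vector_mult_nth P_row_sum)

lemma Lambda_0: "\<Lambda> 0 = 0"
  by (simp add: Lambda_def rho_0)

text \<open>Irreducibility makes \<open>p\<close> positive, so it is the left Perron vector; the
  right one is constant by the row sums.\<close>

lemma stationary_0:
  assumes p: "stationary_distribution P p"
  shows "tilted_stationary P f 0 = p"
proof -
  have 0: "p v* P = 1 *s p" "(\<Sum>x\<in>UNIV. p $ x) = 1" "\<And>x. 0 \<le> p $ x" "p \<noteq> 0"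
    using p by (auto simp: stationary_distribution_def)
  have "transpose P *v p = 1 *s p" using 0(1) by (simp add: transpose_matrix_vector)
  then have pos: "0 < p $ x" for x
    by (rule irreducible_matrix.eigenvector_pos(2)[OF P.irreducible_transpose 0(3,4)])
  have u: "left_perron P = p"
    by (rule P.left_perron_eqI[OF pos 0(1,2)])
  have "right_perron P = 1"
    by (rule P.right_perron_eqI[of _ 1])
      (simp_all add: vec_eq_iff matrix_vector_mult_nth P_row_sum u 0)
  then show ?thesis
    by (simp add: tilted_stationary_def u_vec_def v_vec_def tilted_0 u vec_eq_iff)
qed

end

subsection \<open>Uniform bounds for large tilts\<close>

text \<open>Edge constants multiply along a path, and the product does not depend on the parameter
  \<open>t\<close>.\<close>

lemma trancl_lower_bound:
  fixes V :: "'t \<Rightarrow> 'a \<Rightarrow> real"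
  assumes step: "\<And>x y. (x, y) \<in> R \<Longrightarrow> \<exists>c>0. \<forall>t\<in>T. c * V t y \<le> V t x"
    and "(x, y) \<in> R\<^sup>+"
  shows "\<exists>c>0. \<forall>t\<in>T. c * V t y \<le> V t x"
  using assms(2)
proof (induction rule: trancl_induct)
  case (base y)
  then show ?case by (rule step)
next
  case (step y z)
  obtain c where c: "c > 0" "\<And>t. t \<in> T \<Longrightarrow> c * V t y \<le> V t x" using step.IH by blast
  obtain d where d: "d > 0" "\<And>t. t \<in> T \<Longrightarrow> d * V t z \<le> V t y" using assms(1)[OF step.hyps(2)] by blast
  have "(c * d) * V t z \<le> V t x" if "t \<in> T" for t
    unfolding mult.assoc
    by (rule order_trans[OF mult_left_mono[OF d(2)[OF that] less_imp_le[OF c(1)]] c(2)[OF that]])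
  with c d show ?case by (intro exI[of _ "c * d"]) auto
qed

lemma uniform_lower_bound:
  fixes F G :: "'b \<Rightarrow> 't \<Rightarrow> real"
  assumes "finite B" and nonneg: "\<And>z t. 0 \<le> F z t"
    and "\<And>z. z \<in> B \<Longrightarrow> \<exists>c>0. \<forall>t\<in>T. c * F z t \<le> G z t"
  shows "\<exists>c>0. \<forall>z\<in>B. \<forall>t\<in>T. c * F z t \<le> G z t"
  using assms(1,3)
proof (induction rule: finite_induct)
  case empty
  show ?case by (intro exI[of _ 1]) auto
next
  case (insert z B)
  obtain c where c: "c > 0" "\<And>w t. w \<in> B \<Longrightarrow> t \<in> T \<Longrightarrow> c * F w t \<le> G w t"
    using insert by blast
  obtain d where d: "d > 0" "\<And>t. t \<in> T \<Longrightarrow> d * F z t \<le> G z t"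
    using insert.prems by blast
  have "min c d * F w t \<le> G w t" if "w \<in> insert z B" "t \<in> T" for w t
  proof (cases "w = z")
    case True
    have "min c d * F w t \<le> d * F w t" by (intro mult_right_mono nonneg) simp
    with True d(2)[OF that(2)] show ?thesis by simp
  next
    case False
    have "min c d * F w t \<le> c * F w t" by (intro mult_right_mono nonneg) simp
    with False that c(2)[of w t] show ?thesis by simp
  qed
  with c d show ?case by (intro exI[of _ "min c d"]) auto
qed

lemma finite_argmax:
  fixes k :: "'a \<Rightarrow> real"
  assumes "finite A" "A \<noteq> {}"
  obtains x where "x \<in> A" "\<And>y. y \<in> A \<Longrightarrow> k y \<le> k x"
proof -
  have "Max (k ` A) \<in> k ` A" using assms by (intro Max_in) auto
  then obtain x where "x \<in> A" "Max (k ` A) = k x" by blast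
  moreover have "k y \<le> Max (k ` A)" if "y \<in> A" for y using assms that by simp
  ultimately show thesis using that[of x] by simp
qed

lemma finite_argmin:
  fixes k :: "'a \<Rightarrow> real"
  assumes "finite A" "A \<noteq> {}"
  obtains x where "x \<in> A" "\<And>y. y \<in> A \<Longrightarrow> k x \<le> k y"
  using finite_argmax[OF assms, of "\<lambda>x. - k x"] by (metis neg_le_iff_le)

text \<open>\<open>S_b_proper\<close> excludes constant \<open>f\<close>, for which
  \<open>\<Lambda>''\<close> would vanish.\<close>

locale irreducible_top_chain = irreducible_chain P f
  for P :: "real^'s::finite^'s" and f :: "'s \<Rightarrow> real" +
  fixes a b :: real and S_b :: "'s set"
  assumes f_range: "a \<le> f x" "f x \<le> b"
    and S_b_def: "S_b = {x. f x = b}"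
    and S_b_nonempty: "S_b \<noteq> {}"
    and S_b_proper: "S_b \<noteq> UNIV"
    and irreducible_S_b: "irreducible_on S_b P"
    and S_b_reachable: "x \<notin> S_b \<Longrightarrow> \<exists>y\<in>S_b. 0 < P $ x $ y"
begin

lemma f_S_b: "x \<in> S_b \<longleftrightarrow> f x = b"
  by (simp add: S_b_def)

lemma S_b_step:
  assumes "x \<in> S_b"
  obtains y where "y \<in> S_b" "0 < P $ x $ y"
  using irreducible_on_trancl[OF irreducible_S_b assms assms]
  by (auto simp: edges_def elim: converse_tranclE)

text \<open>The edges whose weight \<open>P $ x $ y * exp (t * b)\<close> stays comparable with
  \<open>\<rho> t\<close> for all nonnegative \<open>t\<close>.\<close>

definition top_edges :: "('s \<times> 's) set" where
  "top_edges = edges P \<inter> UNIV \<times> S_b"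

text \<open>Outside \<open>S_b\<close> one step enters it; inside, irreducibility of the submatrix
  leads to \<open>y\<close>.\<close>

lemma top_edges_trancl:
  assumes y: "y \<in> S_b"
  shows "(x, y) \<in> top_edges\<^sup>+"
proof -
  have in_S_b: "(z, y) \<in> top_edges\<^sup>+" if "z \<in> S_b" for z
    using irreducible_on_trancl[OF irreducible_S_b that y]
    by (rule trancl_mono) (auto simp: top_edges_def)
  show ?thesis
  proof (cases "x \<in> S_b")
    case False
    then obtain z where "z \<in> S_b" "(x, z) \<in> top_edges"
      using S_b_reachable by (auto simp: top_edges_def edges_def)
    with in_S_b show ?thesis by (meson trancl_into_trancl2)
  qed (rule in_S_b)
qed

definition p_min :: real where
  "p_min = Min {P $ x $ y | x y. 0 < P $ x $ y}"

lemma p_min_le: "0 < P $ x $ y \<Longrightarrow> p_min \<le> P $ x $ y"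
  and p_min_pos: "0 < p_min"
proof -
  have "{P $ x $ y | x y. 0 < P $ x $ y} \<subseteq> (\<lambda>(x, y). P $ x $ y) ` UNIV" by auto
  then have fin: "finite {P $ x $ y | x y. 0 < P $ x $ y}" by (rule finite_subset) simp
  then show "0 < P $ x $ y \<Longrightarrow> p_min \<le> P $ x $ y"
    unfolding p_min_def by (intro Min_le) auto
  obtain x where "x \<in> S_b" using S_b_nonempty by blast
  then obtain y where "0 < P $ x $ y" by (rule S_b_step)
  then have "{P $ x $ y | x y. 0 < P $ x $ y} \<noteq> {}" by auto
  with fin have "p_min \<in> {P $ x $ y | x y. 0 < P $ x $ y}"
    unfolding p_min_def by (rule Min_in)
  then show "0 < p_min" by auto
qed

section \<open>Bounds on the spectral radius and on ratios of \<open>v\<close>\<close>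

lemma v_sum_ge: "P $ x $ y * exp (t * f y) * v t y \<le> \<rho> t * v t x"
proof -
  have "P $ x $ y * exp (t * f y) * v t y \<le> (\<Sum>y\<in>UNIV. P $ x $ y * exp (t * f y) * v t y)"
    by (rule member_le_sum) (auto intro!: mult_nonneg_nonneg P_nonneg less_imp_le[OF v_pos])
  then show ?thesis by (simp add: v_sum_eq)
qed

lemma exp_f_le: "0 \<le> t \<Longrightarrow> exp (t * f y) \<le> exp (t * b)"
  by (simp add: mult_left_mono f_range)

lemma rho_le:
  assumes "0 \<le> t"
  shows "\<rho> t \<le> exp (t * b)"
proof -
  \<comment> \<open>The eigenvector equation is read at the maximum of \<open>v t\<close>.\<close>
  obtain x where x: "\<And>y. v t y \<le> v t x"
    using finite_argmax[of UNIV "v t"] by auto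
  have "\<rho> t * v t x = (\<Sum>y\<in>UNIV. P $ x $ y * exp (t * f y) * v t y)" by (simp add: v_sum_eq)
  also have "\<dots> \<le> (\<Sum>y\<in>UNIV. P $ x $ y * exp (t * b) * v t x)"
    by (intro sum_mono mult_mono mult_left_mono exp_f_le x assms P_nonneg mult_nonneg_nonneg)
      (auto simp: less_imp_le v_pos)
  also have "\<dots> = exp (t * b) * v t x"
    by (simp add: P_row_sum flip: sum_distrib_right)
  finally show ?thesis using v_pos[of t x] by simp
qed

lemma rho_ge: "p_min * exp (t * b) \<le> \<rho> t"
proof -
  \<comment> \<open>The eigenvector equation is read at the minimum over \<open>S_b\<close>, keeping
    a single edge inside \<open>S_b\<close>.\<close>
  obtain x where x: "x \<in> S_b" "\<And>y. y \<in> S_b \<Longrightarrow> v t x \<le> v t y"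
    using finite_argmin[of S_b "v t"] S_b_nonempty by auto
  obtain y where y: "y \<in> S_b" "0 < P $ x $ y" using S_b_step[OF x(1)] by blast
  have "p_min * exp (t * b) * v t x \<le> P $ x $ y * exp (t * f y) * v t y"
    using p_min_pos v_pos[of t x] y(1) p_min_le[OF y(2)] x(2)[OF y(1)]
    by (intro mult_mono) (auto simp: f_S_b)
  also have "\<dots> \<le> \<rho> t * v t x" by (rule v_sum_ge)
  finally show ?thesis using v_pos[of t x] by simp
qed

lemma Lambda_ge: "t * b + ln p_min \<le> \<Lambda> t"
proof -
  have "ln (p_min * exp (t * b)) \<le> ln (\<rho> t)"
    using rho_ge[of t] p_min_pos rho_pos[of t] by (intro ln_mono) auto
  then show ?thesis using p_min_pos by (simp add: ln_mult Lambda_def)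
qed

lemma top_edge_bound:
  assumes "(x, y) \<in> top_edges" "0 \<le> t"
  shows "p_min * v t y \<le> v t x"
proof -
  have xy: "0 < P $ x $ y" "f y = b"
    using assms(1) by (auto simp: top_edges_def edges_def f_S_b)
  have "p_min * exp (t * b) * v t y \<le> P $ x $ y * exp (t * f y) * v t y"
    using p_min_le[OF xy(1)] v_pos[of t y] by (simp add: xy)
  also have "\<dots> \<le> \<rho> t * v t x" by (rule v_sum_ge)
  also have "\<dots> \<le> exp (t * b) * v t x"
    using rho_le[OF assms(2)] v_pos[of t x] by simp
  finally have "exp (t * b) * (p_min * v t y) \<le> exp (t * b) * v t x" by (simp add: mult_ac)
  then show ?thesis by simp
qed

lemma v_lower_S_b: "\<exists>c>0. \<forall>x. \<forall>y\<in>S_b. \<forall>t\<ge>0. c * v t y \<le> v t x"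
proof -
  have "\<exists>c>0. \<forall>z\<in>UNIV \<times> S_b. \<forall>t\<in>{0..}. c * v t (snd z) \<le> v t (fst z)"
  proof (rule uniform_lower_bound)
    fix z assume "z \<in> (UNIV :: 's set) \<times> S_b"
    then have "(fst z, snd z) \<in> top_edges\<^sup>+" by (intro top_edges_trancl) auto
    then show "\<exists>c>0. \<forall>t\<in>{0..}. c * v t (snd z) \<le> v t (fst z)"
      by (rule trancl_lower_bound[rotated]) (use top_edge_bound p_min_pos in auto)
  qed (auto simp: less_imp_le v_pos)
  then show ?thesis by force
qed

text \<open>On a bounded range of tilts every edge of \<open>P\<close> loses at most the factor
  \<open>exp (- T * (b - a))\<close>, so paths of arbitrary edges are allowed.\<close>

lemma v_lower_small: "\<exists>c>0. \<forall>x y. \<forall>t\<in>{0..T}. c * v t y \<le> v t x"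
proof -
  have step: "(p_min * exp (- T * (b - a))) * v t y \<le> v t x" if "(x, y) \<in> edges P" "t \<in> {0..T}" for x y t
  proof -
    have P: "0 < P $ x $ y" using that(1) by (simp add: edges_def)
    have "t * (b - a) \<le> T * (b - a)" using that(2) f_range[of x] by (intro mult_right_mono) auto
    moreover have "t * a \<le> t * f y" using that(2) f_range(1) by (intro mult_left_mono) auto
    ultimately have "t * b - T * (b - a) \<le> t * f y" by (simp add: right_diff_distrib)
    then have "exp (t * b) * exp (- T * (b - a)) \<le> exp (t * f y)" by (simp flip: exp_add)
    then have "p_min * (exp (t * b) * exp (- T * (b - a))) * v t y \<le> P $ x $ y * exp (t * f y) * v t y"
      using p_min_le[OF P] p_min_pos P v_pos[of t y] by (intro mult_right_mono mult_mono) auto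
    also have "\<dots> \<le> \<rho> t * v t x" by (rule v_sum_ge)
    also have "\<dots> \<le> exp (t * b) * v t x"
      using rho_le[of t] v_pos[of t x] that(2) by simp
    finally have "exp (t * b) * (p_min * exp (- T * (b - a)) * v t y) \<le> exp (t * b) * v t x"
      by (simp only: mult_ac)
    then show ?thesis by simp
  qed
  have "\<exists>c>0. \<forall>z\<in>UNIV. \<forall>t\<in>{0..T}. c * v t (snd z) \<le> v t (fst z)"
  proof (rule uniform_lower_bound)
    fix z :: "'s \<times> 's"
    have "(fst z, snd z) \<in> (edges P)\<^sup>+"
      using irreducible_on_trancl[OF irreducible_P, of "fst z" "snd z"] by simp
    then show "\<exists>c>0. \<forall>t\<in>{0..T}. c * v t (snd z) \<le> v t (fst z)"
    proof (rule trancl_lower_bound[rotated])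
      fix x y assume "(x, y) \<in> edges P"
      then show "\<exists>c>0. \<forall>t\<in>{0..T}. c * v t y \<le> v t x"
        using step p_min_pos by (intro exI[of _ "p_min * exp (- T * (b - a))"]) auto
    qed
  qed (auto simp: less_imp_le v_pos)
  then show ?thesis by force
qed

text \<open>For large \<open>t\<close> the weights \<open>exp (t * f y)\<close> with \<open>y\<close> outside \<open>S_b\<close> are negligible compared with
  \<open>\<rho> t\<close>, so the maximum of \<open>v t\<close> is controlled by its maximum over \<open>S_b\<close>.\<close>

lemma v_upper_large: "\<exists>T\<ge>0. \<forall>t\<ge>T. \<forall>x. \<exists>z\<in>S_b. p_min / 2 * v t x \<le> v t z"
proof -
  obtain x0 where x0: "x0 \<in> - S_b" "\<And>y. y \<in> - S_b \<Longrightarrow> f y \<le> f x0"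
    using finite_argmax[of "- S_b" f] S_b_proper by auto
  define \<delta> where "\<delta> = b - f x0"
  have \<delta>: "0 < \<delta>" using x0(1) f_range(2)[of x0] by (auto simp: \<delta>_def f_S_b)
  have f_le: "f y \<le> b - \<delta>" if "y \<notin> S_b" for y using x0(2)[of y] that by (simp add: \<delta>_def)
  \<comment> \<open>Beyond \<open>T\<close> the states outside \<open>S_b\<close> contribute at most
    half of the bound \<open>p_min\<close> from \<open>rho_ge\<close>, and that half can be
    absorbed.\<close>
  define T where "T = max 0 (- ln (p_min / 2) / \<delta>)"
  have T: "exp (- t * \<delta>) \<le> p_min / 2" "0 \<le> t" if "T \<le> t" for t
  proof -
    have "- ln (p_min / 2) / \<delta> \<le> t" using that by (simp add: T_def)
    then have "- t * \<delta> \<le> ln (p_min / 2)" using \<delta> by (simp add: field_simps)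
    then have "exp (- t * \<delta>) \<le> exp (ln (p_min / 2))" by (simp only: exp_le_cancel_iff)
    then show "exp (- t * \<delta>) \<le> p_min / 2" using p_min_pos by simp
    show "0 \<le> t" using that by (simp add: T_def)
  qed
  have "\<exists>z\<in>S_b. p_min / 2 * v t w \<le> v t z" if t: "T \<le> t" for t w
  proof -
    obtain x where x: "\<And>y. v t y \<le> v t x"
      using finite_argmax[of UNIV "v t"] by auto
    obtain z where z: "z \<in> S_b" "\<And>y. y \<in> S_b \<Longrightarrow> v t y \<le> v t z"
      using finite_argmax[of S_b "v t"] S_b_nonempty by auto
    \<comment> \<open>The first summand covers targets in \<open>S_b\<close>, the second all
      others.\<close>
    define B where "B = exp (t * b) * (v t z + p_min / 2 * v t x)"
    have le: "exp (t * f y) * v t y \<le> B" for y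
    proof (cases "y \<in> S_b")
      case True
      have "exp (t * f y) * v t y \<le> exp (t * b) * v t z"
        using True z(2) by (simp add: f_S_b)
      also have "\<dots> \<le> B"
        unfolding B_def using p_min_pos v_pos[of t x] by (intro mult_left_mono) auto
      finally show ?thesis .
    next
      case False
      have "t * f y \<le> t * b + (- t * \<delta>)"
        using mult_left_mono[OF f_le[OF False], of t] T(2)[OF t] by (simp add: algebra_simps)
      then have "exp (t * f y) \<le> exp (t * b) * exp (- t * \<delta>)" by (simp only: exp_le_cancel_iff flip: exp_add)
      also have "\<dots> \<le> exp (t * b) * (p_min / 2)" using T(1)[OF t] by simp
      finally have "exp (t * f y) * v t y \<le> exp (t * b) * (p_min / 2) * v t x"
        using x[of y] v_pos[of t y] p_min_pos by (intro mult_mono) auto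
      also have "\<dots> \<le> B" using v_pos[of t z] by (simp add: B_def algebra_simps)
      finally show ?thesis .
    qed
    have "p_min * exp (t * b) * v t x \<le> \<rho> t * v t x"
      using rho_ge[of t] v_pos[of t x] by simp
    also have "\<dots> = (\<Sum>y\<in>UNIV. P $ x $ y * (exp (t * f y) * v t y))"
      by (simp add: mult.assoc flip: v_sum_eq)
    also have "\<dots> \<le> (\<Sum>y\<in>UNIV. P $ x $ y * B)"
      by (intro sum_mono mult_left_mono le P_nonneg)
    also have "\<dots> = B" by (simp add: P_row_sum flip: sum_distrib_right)
    finally have "exp (t * b) * (p_min * v t x) \<le> exp (t * b) * (v t z + p_min / 2 * v t x)"
      by (simp add: B_def mult_ac)
    then have "p_min / 2 * v t x \<le> v t z" by simp
    moreover have "p_min / 2 * v t w \<le> p_min / 2 * v t x" using x[of w] p_min_pos by simp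
    ultimately show ?thesis using z(1) by force
  qed
  then show ?thesis by (intro exI[of _ T]) (auto simp: T_def)
qed

text \<open>Small tilts are covered by \<open>v_lower_small\<close>; for large ones,
  \<open>v t x\<close> is compared with a value on \<open>S_b\<close>, and that value with
  \<open>v t y\<close>.\<close>

lemma v_ratio_bounded: "\<exists>K>0. \<forall>t\<ge>0. \<forall>x y. v t x / v t y \<le> K"
proof -
  obtain T where T: "\<And>t x. T \<le> t \<Longrightarrow> \<exists>z\<in>S_b. p_min / 2 * v t x \<le> v t z" using v_upper_large by blast
  obtain c where c: "c > 0" "\<And>x y t. y \<in> S_b \<Longrightarrow> t \<ge> 0 \<Longrightarrow> c * v t y \<le> v t x" using v_lower_S_b by blast
  obtain d where d: "d > 0" "\<And>x y t. t \<in> {0..T} \<Longrightarrow> d * v t y \<le> v t x" using v_lower_small by blast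
  define e where "e = min d (c * (p_min / 2))"
  have e: "e > 0" using c d p_min_pos by (simp add: e_def)
  have "e * v t x \<le> v t y" if t: "0 \<le> t" for t x y
  proof (cases "t \<le> T")
    case True
    have "e * v t x \<le> d * v t x" using v_pos[of t x] by (simp add: e_def)
    with d(2)[of t x y] True t show ?thesis by simp
  next
    case False
    then obtain z where z: "z \<in> S_b" "p_min / 2 * v t x \<le> v t z" using T[of t x] by auto
    have "e * v t x \<le> c * (p_min / 2) * v t x" using v_pos[of t x] by (intro mult_right_mono) (auto simp: e_def)
    also have "\<dots> \<le> c * v t z" using z(2) c(1) by (simp add: mult.assoc)
    also have "\<dots> \<le> v t y" by (rule c(2)[OF z(1) t])
    finally show ?thesis .
  qed
  then have "v t x / v t y \<le> 1 / e" if "0 \<le> t" for t x y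
    using that e v_pos[of t y] by (simp add: field_simps)
  with e show ?thesis by (intro exI[of _ "1 / e"]) auto
qed

section \<open>Bounds on the mean and on the oscillation of \<open>g\<close>\<close>

lemma mean_le: "M t \<le> b" and mean_ge: "a \<le> M t" and mean_less: "M t < b"
proof -
  have "(\<Sum>x\<in>UNIV. f x * \<pi> t x) \<le> (\<Sum>x\<in>UNIV. b * \<pi> t x)"
    by (intro sum_mono mult_right_mono f_range) (auto simp: less_imp_le stationary_pos)
  then show "M t \<le> b" by (simp add: mean_def stationary_sum flip: sum_distrib_left)
  have "(\<Sum>x\<in>UNIV. a * \<pi> t x) \<le> (\<Sum>x\<in>UNIV. f x * \<pi> t x)"
    by (intro sum_mono mult_right_mono f_range) (auto simp: less_imp_le stationary_pos)
  then show "a \<le> M t" by (simp add: mean_def stationary_sum flip: sum_distrib_left)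
  obtain x where "f x < b" using S_b_proper f_range(2) by (auto simp: S_b_def less_le)
  then have "(\<Sum>x\<in>UNIV. f x * \<pi> t x) < (\<Sum>x\<in>UNIV. b * \<pi> t x)"
    by (intro sum_strict_mono_ex1 ballI mult_right_mono f_range bexI[of _ x])
      (auto simp: less_imp_le stationary_pos)
  then show "M t < b" by (simp add: mean_def stationary_sum flip: sum_distrib_left)
qed

text \<open>A function satisfying the one-step inequality below cannot drop much along an edge whose
  \<open>Q\<close>-probability is bounded below, starting from a point close to its maximum.\<close>

definition near_subharmonic :: "real \<Rightarrow> real \<Rightarrow> ('s \<Rightarrow> real) \<Rightarrow> bool" where
  "near_subharmonic t G k \<longleftrightarrow> 0 \<le> t \<and> (\<forall>x. k x \<le> G) \<and>
     (\<forall>x. k x \<le> (\<Sum>y\<in>UNIV. Q t x y * k y) + (b - a))"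

text \<open>Each edge turns a defect \<open>D\<close> into at most
  \<open>(D + (b - a)) / \<epsilon>\<close>. The order of quantifiers matters: \<open>D'\<close>
  depends on the path and \<open>D\<close> only, not on \<open>t\<close>, \<open>G\<close> or
  \<open>k\<close>.\<close>

lemma near_subharmonic_path:
  assumes "(x, y) \<in> top_edges\<^sup>+"
  shows "\<exists>D'. \<forall>t G k. near_subharmonic t G k \<longrightarrow> G - k x \<le> D \<longrightarrow> G - k y \<le> D'"
proof -
  obtain K where K: "K > 0" "\<And>t x y. t \<ge> 0 \<Longrightarrow> v t x / v t y \<le> K" using v_ratio_bounded by blast
  \<comment> \<open>A lower bound for \<open>Q\<close> on \<open>top_edges\<close>:
    \<open>p_min\<close> bounds the entry of \<open>P\<close>, \<open>1 / K\<close> the ratio of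
    \<open>v\<close>, and \<open>exp (t * b) / \<rho> t\<close> is at least one.\<close>
  define \<epsilon> where "\<epsilon> = p_min / K"
  have \<epsilon>: "0 < \<epsilon>" using p_min_pos K(1) by (simp add: \<epsilon>_def)
  have Q_ge: "\<epsilon> \<le> Q t x y" if e: "(x, y) \<in> top_edges" and t: "0 \<le> t" for t x y
  proof -
    have xy: "0 < P $ x $ y" "f y = b" using e by (auto simp: top_edges_def edges_def f_S_b)
    have "v t x * 1 \<le> K * v t y" using K(2)[OF t, of x y] v_pos[of t y] by (simp add: field_simps)
    then have "p_min * v t x \<le> P $ x $ y * (K * v t y)"
      using p_min_le[OF xy(1)] p_min_pos v_pos[of t x] by (intro mult_mono) auto
    then have "\<epsilon> * v t x \<le> P $ x $ y * v t y" using K(1) by (simp add: \<epsilon>_def field_simps)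
    then have "\<rho> t * (\<epsilon> * v t x) \<le> exp (t * b) * (P $ x $ y * v t y)"
      by (rule mult_mono[OF rho_le[OF t]]) (use \<epsilon> v_pos[of t x] in auto)
    then show ?thesis using rho_pos[of t] v_pos[of t x] by (simp add: Q_eq xy(2) field_simps)
  qed
  have edge: "G - k y \<le> (D + (b - a)) / \<epsilon>"
    if k: "near_subharmonic t G k" and D: "G - k x \<le> D" and e: "(x, y) \<in> top_edges" for t G k x y D
  proof -
    have t: "0 \<le> t" and G: "\<And>x. k x \<le> G" using k by (auto simp: near_subharmonic_def)
    \<comment> \<open>All \<open>G - k y\<close> are nonnegative, so a single edge is controlled by
      the average defect.\<close>
    have "\<epsilon> * (G - k y) \<le> Q t x y * (G - k y)"
      using Q_ge[OF e t] G[of y] by (intro mult_right_mono) auto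
    also have "\<dots> \<le> (\<Sum>y\<in>UNIV. Q t x y * (G - k y))"
      by (rule member_le_sum) (auto intro!: mult_nonneg_nonneg Q_nonneg simp: G)
    also have "\<dots> = G - (\<Sum>y\<in>UNIV. Q t x y * k y)"
      by (simp add: right_diff_distrib sum_subtractf Q_row_sum flip: sum_distrib_right)
    also have "\<dots> \<le> D + (b - a)" using k D by (auto simp: near_subharmonic_def dest: spec[of _ x])
    finally show ?thesis using \<epsilon> by (simp add: field_simps)
  qed
  show ?thesis
    using assms
  proof (induction rule: trancl_induct)
    case (base y)
    then show ?case using edge by blast
  next
    case (step y z)
    then show ?case using edge by meson
  qed
qed

text \<open>In the Poisson equation both \<open>M t\<close> and the conditional mean of
  \<open>f\<close> lie in \<open>[a, b]\<close>, so either sign of \<open>g\<close> has error at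
  most \<open>b - a\<close>.\<close>

lemma g_near_subharmonic:
  assumes "0 \<le> t"
  shows "(\<And>x. g t x \<le> G) \<Longrightarrow> near_subharmonic t G (g t)"
    and "(\<And>x. - g t x \<le> G) \<Longrightarrow> near_subharmonic t G (\<lambda>x. - g t x)"
proof -
  have *: "g t x = (\<Sum>y\<in>UNIV. Q t x y * g t y) + (\<Sum>y\<in>UNIV. Q t x y * f y) - M t" for x
    using poisson_equation[of t x]
    by (simp add: distrib_left right_diff_distrib sum.distrib sum_subtractf Q_row_sum flip: sum_distrib_right)
  have "(\<Sum>y\<in>UNIV. Q t x y * f y) \<le> (\<Sum>y\<in>UNIV. Q t x y * b)" for x
    by (intro sum_mono mult_left_mono f_range Q_nonneg)
  then have up: "(\<Sum>y\<in>UNIV. Q t x y * f y) \<le> b" for x by (simp add: Q_row_sum flip: sum_distrib_right)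
  have "(\<Sum>y\<in>UNIV. Q t x y * a) \<le> (\<Sum>y\<in>UNIV. Q t x y * f y)" for x
    by (intro sum_mono mult_left_mono f_range Q_nonneg)
  then have lo: "a \<le> (\<Sum>y\<in>UNIV. Q t x y * f y)" for x by (simp add: Q_row_sum flip: sum_distrib_right)
  have 1: "g t x \<le> (\<Sum>y\<in>UNIV. Q t x y * g t y) + (b - a)" for x
    using *[of x] up[of x] mean_ge[of t] by linarith
  have 2: "- g t x \<le> (\<Sum>y\<in>UNIV. Q t x y * - g t y) + (b - a)" for x
    using *[of x] lo[of x] mean_le[of t] by (simp add: sum_negf)
  show "(\<And>x. g t x \<le> G) \<Longrightarrow> near_subharmonic t G (g t)"
    using 1 assms unfolding near_subharmonic_def by blast
  show "(\<And>x. - g t x \<le> G) \<Longrightarrow> near_subharmonic t G (\<lambda>x. - g t x)"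
    using 2 assms unfolding near_subharmonic_def by blast
qed

text \<open>Maximum and minimum of \<open>g t\<close> are both compared with the value at one fixed
  state \<open>y0\<close>, starting from defect zero.\<close>

lemma g_oscillation_bounded: "\<exists>D. \<forall>t\<ge>0. \<forall>x y. g t x - g t y \<le> D"
proof -
  obtain y0 where y0: "y0 \<in> S_b" using S_b_nonempty by blast
  have "\<forall>x. \<exists>D'. \<forall>t G k. near_subharmonic t G k \<longrightarrow> G - k x \<le> 0 \<longrightarrow> G - k y0 \<le> D'"
    using near_subharmonic_path[OF top_edges_trancl[OF y0]] by blast
  then obtain D where D: "\<And>x t G k. near_subharmonic t G k \<Longrightarrow> G - k x \<le> 0 \<Longrightarrow> G - k y0 \<le> D x"
    by metis
  define D' where "D' = Max (range D)"
  have D': "D x \<le> D'" for x by (simp add: D'_def)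
  have "g t x - g t y \<le> 2 * D'" if t: "0 \<le> t" for t x y
  proof -
    obtain x1 where x1: "\<And>y. g t y \<le> g t x1" using finite_argmax[of UNIV "g t"] by auto
    obtain x2 where x2: "\<And>y. g t x2 \<le> g t y" using finite_argmin[of UNIV "g t"] by auto
    have "g t x1 - g t y0 \<le> D x1"
      by (rule D[OF g_near_subharmonic(1)[OF t x1]]) simp
    moreover have "- g t x2 - (- g t y0) \<le> D x2"
      by (rule D[OF g_near_subharmonic(2)[OF t], of "- g t x2"]) (use x2 in auto)
    ultimately show ?thesis using D'[of x1] D'[of x2] x1[of x] x2[of y] by linarith
  qed
  then show ?thesis by blast
qed

lemma v_ratio_deriv_bounded:
  "\<exists>L. \<forall>t\<ge>0. \<forall>x y. \<bar>v t x / v t y * (g t x - g t y)\<bar> \<le> L"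
proof -
  obtain K where K: "K > 0" "\<And>t x y. t \<ge> 0 \<Longrightarrow> v t x / v t y \<le> K" using v_ratio_bounded by blast
  obtain D where D: "\<And>t x y. t \<ge> 0 \<Longrightarrow> g t x - g t y \<le> D" using g_oscillation_bounded by blast
  have "\<bar>v t x / v t y * (g t x - g t y)\<bar> \<le> K * D" if t: "0 \<le> t" for t x y
  proof -
    have "\<bar>g t x - g t y\<bar> \<le> D" using D[OF t, of x y] D[OF t, of y x] by linarith
    then show ?thesis
      using K(2)[OF t, of x y] K(1) v_pos[of t x] v_pos[of t y]
      by (simp only: abs_mult) (intro mult_mono, auto)
  qed
  then show ?thesis by blast
qed

subsection \<open>The second derivative of the log-spectral radius\<close>

text \<open>With \<open>X\<close> the increment,
  \<open>(X - \<alpha>) * (\<beta> - X) \<ge> 0\<close> bounds \<open>h\<^sup>2\<close> by an affine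
  function of \<open>h\<close>, whose linear part averages to zero.\<close>

lemma W_popoviciu:
  assumes "\<And>x y. \<alpha> \<le> f y + g t y - g t x" "\<And>x y. f y + g t y - g t x \<le> \<beta>"
  shows "W t \<le> (\<beta> - \<alpha>)\<^sup>2 / 4"
proof -
  have "(h t x y)\<^sup>2 \<le> (M t - \<alpha>) * (\<beta> - M t) + (\<alpha> + \<beta> - 2 * M t) * h t x y" for x y
    using mult_nonneg_nonneg[of "f y + g t y - g t x - \<alpha>" "\<beta> - (f y + g t y - g t x)"] assms[of y x]
    by (simp add: h_def power2_eq_square algebra_simps)
  then have "W t \<le> (\<Sum>x\<in>UNIV. \<Sum>y\<in>UNIV. \<pi> t x * Q t x y *
      ((M t - \<alpha>) * (\<beta> - M t) + (\<alpha> + \<beta> - 2 * M t) * h t x y))"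
    unfolding W_def
    by (intro sum_mono mult_left_mono mult_nonneg_nonneg Q_nonneg less_imp_le[OF stationary_pos])
  also have "\<dots> = (\<Sum>x\<in>UNIV. \<pi> t x * ((M t - \<alpha>) * (\<beta> - M t) * (\<Sum>y\<in>UNIV. Q t x y)
      + (\<alpha> + \<beta> - 2 * M t) * (\<Sum>y\<in>UNIV. Q t x y * h t x y)))"
    unfolding sum_distrib_left sum.distrib[symmetric]
    by (intro sum.cong refl) (simp add: algebra_simps)
  also have "\<dots> = (M t - \<alpha>) * (\<beta> - M t)"
    by (simp add: Q_row_sum h_mean_zero stationary_sum flip: sum_distrib_right)
  also have "\<dots> \<le> (\<beta> - \<alpha>)\<^sup>2 / 4"
    using zero_le_power2[of "2 * M t - \<alpha> - \<beta>"] by (simp add: power2_eq_square field_simps)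
  finally show ?thesis .
qed

lemma W_le:
  assumes K: "\<And>x y. v t x / v t y \<le> K"
    and L: "\<And>x y. \<bar>v t x / v t y * (g t x - g t y)\<bar> \<le> L"
  shows "W t \<le> (b - a + 2 * K * L)\<^sup>2 / 4"
proof -
  have "\<bar>g t y - g t x\<bar> \<le> K * L" for x y
  proof -
    \<comment> \<open>The inserted ratio and its inverse produce the quantities bounded by
      \<open>K\<close> and \<open>L\<close>.\<close>
    have "\<bar>g t y - g t x\<bar> = v t x / v t y * \<bar>v t y / v t x * (g t y - g t x)\<bar>"
      using v_pos[of t x] v_pos[of t y] by (simp add: abs_mult)
    also have "\<dots> \<le> K * L"
      using K[of x y] L[of y x] v_pos[of t x] v_pos[of t y] order_trans[OF _ K[of x y], of 0]
      by (intro mult_mono) auto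
    finally show ?thesis .
  qed
  then have "W t \<le> ((b + K * L) - (a - K * L))\<^sup>2 / 4"
    using f_range by (intro W_popoviciu) (smt (verit))+
  then show ?thesis by (simp add: algebra_simps)
qed

text \<open>If the variance vanished, \<open>g\<close> would strictly decrease along every edge inside \<open>S_b\<close>.\<close>

lemma W_pos: "0 < W t"
proof (rule ccontr)
  assume "\<not> 0 < W t"
  moreover have nn: "0 \<le> \<pi> t x * Q t x y * (h t x y)\<^sup>2" for x y
    by (intro mult_nonneg_nonneg Q_nonneg less_imp_le[OF stationary_pos] zero_le_power2)
  then have "0 \<le> W t" unfolding W_def by (intro sum_nonneg)
  ultimately have "W t = 0" by simp
  then have zero: "\<pi> t x * Q t x y * (h t x y)\<^sup>2 = 0" for x y
    unfolding W_def by (subst (asm) sum_nonneg_eq_0_iff) (auto simp: sum_nonneg_eq_0_iff nn intro: sum_nonneg)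
  obtain x where x: "x \<in> S_b" "\<And>y. y \<in> S_b \<Longrightarrow> g t x \<le> g t y"
    using finite_argmin[of S_b "g t"] S_b_nonempty by auto
  obtain y where y: "y \<in> S_b" "0 < P $ x $ y" using S_b_step[OF x(1)] by blast
  have "h t x y = 0"
    using zero[of x y] stationary_pos[of t x] y(2) Q_pos_iff[of t x y] by auto
  then have "g t x - g t y = b - M t" using y(1) by (simp add: h_def f_S_b)
  with x(2)[OF y(1)] mean_less[of t] show False by simp
qed

subsection \<open>The relative entropy as a function of the tilt\<close>

text \<open>The Legendre transform of \<open>\<Lambda>\<close> at the mean
  \<open>M t\<close>.\<close>

definition D\<^sub>0 :: "real \<Rightarrow> real" where
  "D\<^sub>0 t = t * M t - \<Lambda> t"

lemma entropy_eq: "rel_entropy_rate P f t 0 = D\<^sub>0 t"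
  by (simp add: rel_entropy_rate_eq Lambda_0 D\<^sub>0_def)

lemma entropy_deriv: "(D\<^sub>0 has_real_derivative t * W t) (at t)"
  unfolding D\<^sub>0_def[abs_def]
  by (auto intro!: derivative_eq_intros mean_deriv Lambda_deriv)

lemma entropy_ge:
  assumes t: "0 \<le> t" and s: "0 < s" "\<And>t. 0 \<le> t \<Longrightarrow> W t \<le> s"
  shows "(M t - M 0)\<^sup>2 / (2 * s) \<le> D\<^sub>0 t"
proof -
  have lin: "M r - M 0 \<le> s * r" if r: "0 \<le> r" for r
  proof -
    have "s * 0 - M 0 \<le> s * r - M r"
    proof (rule DERIV_nonneg_imp_nondecreasing[OF r])
      fix x assume "0 \<le> x" "x \<le> r"
      have "((\<lambda>t. s * t - M t) has_real_derivative s - W x) (at x)"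
        by (auto intro!: derivative_eq_intros mean_deriv)
      with s(2)[OF \<open>0 \<le> x\<close>] show "\<exists>y. ((\<lambda>t. s * t - M t) has_real_derivative y) (at x) \<and> 0 \<le> y"
        by (intro exI[of _ "s - W x"]) auto
    qed
    then show ?thesis by simp
  qed
  \<comment> \<open>Its derivative \<open>W x * (x - (M x - M 0) / s)\<close> is nonnegative by
    \<open>lin\<close>.\<close>
  define F where "F = (\<lambda>r. D\<^sub>0 r - (M r - M 0)\<^sup>2 / (2 * s))"
  have "F 0 \<le> F t"
  proof (rule DERIV_nonneg_imp_nondecreasing[OF t])
    fix x assume x: "0 \<le> x" "x \<le> t"
    have "(F has_real_derivative W x * (x - (M x - M 0) / s)) (at x)"
      unfolding F_def using s(1)
      by (auto intro!: derivative_eq_intros mean_deriv entropy_deriv simp: field_simps)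
    moreover have "(M x - M 0) / s \<le> x" using lin[OF x(1)] s(1) by (simp add: field_simps)
    then have "0 \<le> W x * (x - (M x - M 0) / s)" using W_pos[of x] by (intro mult_nonneg_nonneg) auto
    ultimately show "\<exists>y. (F has_real_derivative y) (at x) \<and> 0 \<le> y" by blast
  qed
  then show ?thesis by (simp add: F_def D\<^sub>0_def Lambda_0)
qed

section \<open>Inverting the mean and passing to the endpoint\<close>

lemma mean_strict_mono: "strict_mono M"
proof (rule strict_monoI)
  fix s t :: real assume "s < t"
  then show "M s < M t"
    by (rule DERIV_pos_imp_increasing) (use mean_deriv W_pos in blast)
qed

lemma entropy_mono:
  assumes "0 \<le> s" "s \<le> t"
  shows "D\<^sub>0 s \<le> D\<^sub>0 t"
proof (rule DERIV_nonneg_imp_nondecreasing[OF assms(2)])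
  fix x assume "s \<le> x" "x \<le> t"
  then have "0 \<le> x * W x" using assms(1) W_pos[of x] by (intro mult_nonneg_nonneg) auto
  with entropy_deriv show "\<exists>y. (D\<^sub>0 has_real_derivative y) (at x) \<and> 0 \<le> y" by blast
qed

lemma entropy_le:
  assumes "0 \<le> t"
  shows "D\<^sub>0 t \<le> - ln p_min"
  using mult_left_mono[OF mean_le[of t] assms] Lambda_ge[of t] by (simp add: D\<^sub>0_def)

text \<open>Monotone and bounded; this makes the \<open>Lim\<close> in the endpoint case of
  \<open>rel_entropy_mean\<close> a genuine limit.\<close>

lemma entropy_convergent: "\<exists>l. (D\<^sub>0 \<longlongrightarrow> l) at_top"
proof
  have bdd: "bdd_above (D\<^sub>0 ` {0..})" by (rule bdd_aboveI2[where M = "- ln p_min"]) (simp add: entropy_le)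
  show "(D\<^sub>0 \<longlongrightarrow> (SUP t\<in>{0..}. D\<^sub>0 t)) at_top"
  proof (rule increasing_tendsto)
    show "\<forall>\<^sub>F t in at_top. D\<^sub>0 t \<le> (SUP t\<in>{0..}. D\<^sub>0 t)"
      using eventually_ge_at_top[of 0] by eventually_elim (auto intro: cSUP_upper bdd)
  next
    fix x assume "x < (SUP t\<in>{0..}. D\<^sub>0 t)"
    then obtain s where s: "0 \<le> s" "x < D\<^sub>0 s" using less_cSUP_iff[OF _ bdd, of x] by auto
    show "\<forall>\<^sub>F t in at_top. x < D\<^sub>0 t"
      using eventually_ge_at_top[of s] by eventually_elim (use s entropy_mono in fastforce)
  qed
qed

text \<open>Nonnegative entropy gives
  \<open>t * M t \<ge> \<Lambda> t \<ge> t * b + ln p_min\<close>; division by \<open>t\<close>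
  squeezes the mean.\<close>

lemma mean_tendsto: "(M \<longlongrightarrow> b) at_top"
proof (rule tendsto_sandwich)
  show "\<forall>\<^sub>F t in at_top. b + ln p_min / t \<le> M t"
    using eventually_gt_at_top[of 0]
  proof eventually_elim
    case (elim t)
    have "0 \<le> D\<^sub>0 t" using entropy_mono[of 0 t] elim by (simp add: D\<^sub>0_def Lambda_0)
    then have "t * b + ln p_min \<le> t * M t" using Lambda_ge[of t] by (simp add: D\<^sub>0_def)
    then show ?case using elim by (simp add: field_simps)
  qed
  show "\<forall>\<^sub>F t in at_top. M t \<le> b" by (simp add: mean_le)
  have "((\<lambda>t. b + ln p_min / t) \<longlongrightarrow> b + 0) at_top"
    by (intro tendsto_intros tendsto_divide_0[OF tendsto_const]) (simp add: filterlim_at_top_imp_at_infinity filterlim_ident)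
  then show "((\<lambda>t. b + ln p_min / t) \<longlongrightarrow> b) at_top" by simp
qed auto

lemma mean_surj:
  assumes "M 0 \<le> \<mu>" "\<mu> < b"
  obtains t where "0 \<le> t" "M t = \<mu>"
proof -
  have "\<forall>\<^sub>F t in at_top. 0 \<le> t \<and> \<mu> < M t"
    using order_tendstoD(1)[OF mean_tendsto assms(2)] eventually_ge_at_top[of 0] by eventually_elim simp
  then obtain r where "0 \<le> r" "\<mu> < M r" by (auto simp: eventually_at_top_linorder)
  moreover have "\<forall>x. 0 \<le> x \<and> x \<le> r \<longrightarrow> isCont M x" using mean_deriv DERIV_isCont by blast
  ultimately show thesis using IVT[of M 0 \<mu> r] assms(1) that by auto
qed

lemma param_of_mean_eq: "param_of_mean P f (M t) = t"
  unfolding param_of_mean_def deriv_Lambda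
  using strict_mono_eq[OF mean_strict_mono] by (intro the_equality) auto

text \<open>At \<open>\<mu> = b\<close> the bound for finite tilts passes to the limit; below, it is
  read at the tilt with mean \<open>\<mu>\<close>.\<close>

lemma rel_entropy_mean_ge:
  assumes \<mu>: "M 0 \<le> \<mu>" "\<mu> \<le> b" and b: "b = Max (range f)"
    and s: "0 < s" "\<And>t. 0 \<le> t \<Longrightarrow> W t \<le> s"
  shows "(\<mu> - M 0)\<^sup>2 / (2 * s) \<le> rel_entropy_mean P f \<mu> (M 0)"
proof (cases "\<mu> = b")
  case True
  obtain l where l: "(D\<^sub>0 \<longlongrightarrow> l) at_top" using entropy_convergent by blast
  have "((\<lambda>t. (M t - M 0)\<^sup>2 / (2 * s)) \<longlongrightarrow> (b - M 0)\<^sup>2 / (2 * s)) at_top"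
    using s(1) by (intro tendsto_intros mean_tendsto) auto
  then have "(b - M 0)\<^sup>2 / (2 * s) \<le> l"
    by (rule tendsto_le[OF _ l, rotated])
      (auto intro: eventually_mono[OF eventually_ge_at_top[of 0]] entropy_ge s)
  moreover have "rel_entropy_mean P f b (M 0) = l"
    using tendsto_Lim[OF _ l] by (simp add: rel_entropy_mean_def b[symmetric] param_of_mean_eq entropy_eq)
  ultimately show ?thesis using True by simp
next
  case False
  with \<mu> obtain t where t: "0 \<le> t" "M t = \<mu>" using mean_surj[of \<mu>] by auto
  have "rel_entropy_mean P f (M t) (M 0) = D\<^sub>0 t"
    unfolding rel_entropy_mean_def b[symmetric] param_of_mean_eq entropy_eq using t False by simp
  with entropy_ge[OF t(1) s] t show ?thesis by simp
qed

section \<open>Finiteness of the constants\<close>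

lemma sigma_u_sq_eq: "sigma_u_sq P f = (SUP t\<in>{0..}. ereal (W t))"
  by (simp add: sigma_u_sq_def deriv_Lambda deriv_mean)

lemma L_u_eq: "L_u P f = (SUP t\<in>{0..}. SUP x. SUP y. ereal \<bar>v t x / v t y * (g t x - g t y)\<bar>)"
  unfolding L_u_def using ratio_deriv[THEN DERIV_imp_deriv] by simp

lemma K_u_real:
  obtains K where "K_u P f = ereal K" "\<And>t x y. 0 \<le> t \<Longrightarrow> v t x / v t y \<le> K"
proof -
  have ge: "ereal (v t x / v t y) \<le> K_u P f" if "0 \<le> t" for t x y
    unfolding K_u_def using that by (intro SUP_upper2[of t] SUP_upper2[of x] SUP_upper2[of y]) auto
  obtain K where "\<And>t x y. t \<ge> 0 \<Longrightarrow> v t x / v t y \<le> K" using v_ratio_bounded by blast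
  then have "K_u P f \<le> ereal K" unfolding K_u_def by (intro SUP_least) auto
  \<comment> \<open>One arbitrary term of the supremum rules out minus infinity.\<close>
  with ge[of 0 undefined undefined] that ge show thesis by (cases "K_u P f") auto
qed

lemma L_u_real:
  obtains L where "L_u P f = ereal L"
    "\<And>t x y. 0 \<le> t \<Longrightarrow> \<bar>v t x / v t y * (g t x - g t y)\<bar> \<le> L"
proof -
  have ge: "ereal \<bar>v t x / v t y * (g t x - g t y)\<bar> \<le> L_u P f" if "0 \<le> t" for t x y
    unfolding L_u_eq using that by (intro SUP_upper2[of t] SUP_upper2[of x] SUP_upper2[of y]) auto
  obtain L where "\<And>t x y. t \<ge> 0 \<Longrightarrow> \<bar>v t x / v t y * (g t x - g t y)\<bar> \<le> L"
    using v_ratio_deriv_bounded by blast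
  then have "L_u P f \<le> ereal L" unfolding L_u_eq by (intro SUP_least) auto
  with ge[of 0 undefined undefined] that ge show thesis by (cases "L_u P f") auto
qed

lemma sigma_u_sq_real:
  assumes "K_u P f = ereal K" "L_u P f = ereal L"
  obtains s where "sigma_u_sq P f = ereal s" "0 < s" "\<And>t. 0 \<le> t \<Longrightarrow> W t \<le> s"
    "s \<le> (b - a + 2 * K * L)\<^sup>2 / 4"
proof -
  have "v t x / v t y \<le> K" "\<bar>v t x / v t y * (g t x - g t y)\<bar> \<le> L" if "0 \<le> t" for t x y
    using that assms by (metis K_u_real ereal.inject, metis L_u_real ereal.inject)
  then have "W t \<le> (b - a + 2 * K * L)\<^sup>2 / 4" if "0 \<le> t" for t
    using that by (intro W_le)
  then have "sigma_u_sq P f \<le> ereal ((b - a + 2 * K * L)\<^sup>2 / 4)"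
    unfolding sigma_u_sq_eq by (intro SUP_least) simp
  moreover have ge: "ereal (W t) \<le> sigma_u_sq P f" if "0 \<le> t" for t
    unfolding sigma_u_sq_eq using that by (intro SUP_upper) auto
  moreover have "0 < sigma_u_sq P f" using ge[of 0] W_pos[of 0] by (metis ereal_less(2) order_less_le_trans order_refl)
  ultimately show thesis using that by (cases "sigma_u_sq P f") auto
qed

end

theorem lemma8:
  fixes P :: "real^'s^'s" and \<pi> :: "real^'s" and f :: "'s::finite \<Rightarrow> real"
    and a b :: real and S_b :: "'s set"
  assumes "stochastic_matrix P"
    and "irreducible_on UNIV P"
    and "stationary_distribution P \<pi>"
    and "a = Min (range f)"
    and "b = Max (range f)"
    and "a < b"
    and "S_b = {x. f x = b}"
    and "irreducible_on S_b P"
    and "\<forall>x. x \<notin> S_b \<longrightarrow> (\<exists>y\<in>S_b. 0 < P $ x $ y)"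
  shows "0 < sigma_u_sq P f \<and> sigma_u_sq P f < \<infinity> \<and> K_u P f < \<infinity> \<and> L_u P f < \<infinity> \<and>
    (\<forall>\<mu>. mean \<pi> f \<le> \<mu> \<and> \<mu> \<le> b \<longrightarrow>
       ereal (rel_entropy_mean P f \<mu> (mean \<pi> f))
         \<ge> ereal (1 / 2) * (ereal ((\<mu> - mean \<pi> f)\<^sup>2) / sigma_u_sq P f) \<and>
       ereal (1 / 2) * (ereal ((\<mu> - mean \<pi> f)\<^sup>2) / sigma_u_sq P f)
         \<ge> 2 * (ereal ((\<mu> - mean \<pi> f)\<^sup>2) / (ereal (b - a) + 2 * K_u P f * L_u P f)\<^sup>2))"
proof -
  interpret irreducible_top_chain P f a b S_b
  proof
    show "stochastic_matrix P" "irreducible_on UNIV P" "S_b = {x. f x = b}" "irreducible_on S_b P"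
      by fact+
    show "a \<le> f x" "f x \<le> b" for x using assms(4,5) by auto
    have "b \<in> range f" "a \<in> range f" unfolding assms(4,5) by (auto intro: Max_in Min_in)
    then show "S_b \<noteq> {}" "S_b \<noteq> UNIV"
      using assms(6,7) by (auto, metis UNIV_I less_irrefl mem_Collect_eq)
    show "\<exists>y\<in>S_b. 0 < P $ x $ y" if "x \<notin> S_b" for x using assms(9) that by blast
  qed
  have mean0: "mean \<pi> f = M 0" using stationary_0[OF assms(3)] by simp
  obtain K where K: "K_u P f = ereal K" by (rule K_u_real)
  obtain L where L: "L_u P f = ereal L" by (rule L_u_real)
  obtain s where s: "sigma_u_sq P f = ereal s" "0 < s" "\<And>t. 0 \<le> t \<Longrightarrow> W t \<le> s"
    "s \<le> (b - a + 2 * K * L)\<^sup>2 / 4"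
    using sigma_u_sq_real[OF K L] by blast
  define c where "c = b - a + 2 * K * L"
  \<comment> \<open>Positivity follows from \<open>0 < s\<close>, whatever the signs of
    \<open>K\<close> and \<open>L\<close>, and makes the division by \<open>c\<^sup>2\<close>
    genuine.\<close>
  have c: "0 < c\<^sup>2" "4 * s \<le> c\<^sup>2" using s(2,4) by (auto simp: c_def)
  have c_eq: "ereal (b - a) + 2 * K_u P f * L_u P f = ereal c"
    by (simp add: K L c_def)
  have ineq: "2 * (d / c\<^sup>2) \<le> 1 / 2 * (d / s)" if "0 \<le> d" for d :: real
    using mult_right_mono[OF c(2) that] c(1) s(2) by (simp add: field_simps)
  have "1 / 2 * ((\<mu> - M 0)\<^sup>2 / s) \<le> rel_entropy_mean P f \<mu> (M 0)" if "M 0 \<le> \<mu>" "\<mu> \<le> b" for \<mu>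
    using rel_entropy_mean_ge[OF that assms(5) s(2,3)] by simp
  moreover have "ereal (1 / 2) * (ereal d / sigma_u_sq P f) = ereal (1 / 2 * (d / s))" for d
    using s(1,2) by simp
  moreover have "2 * (ereal d / (ereal c)\<^sup>2) = ereal (2 * (d / c\<^sup>2))" for d
    using c(1) by simp
  ultimately show ?thesis
    unfolding mean0 c_eq using s(1,2) K L ineq by simp
qed

end
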